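(* Let $T$ and $S$ be self-adjoint subspaces in $X^2$. If $T$ is a compact perturbation of $S$, then $\sigma_e(T)=\sigma_e(S)$; consequently $\sigma_e(S)=\emptyset$ if and only if $\sigma_e(T)=\emptyset$ (i.e. $S$ has purely discrete spectrum if and only if $T$ does).
   Context: $X$ is a complex Hilbert space and $X^2=X\times X$ carries the inner product $\langle (x,f),(y,g)\rangle=\langle x,y\rangle+\langle f,g\rangle$. A subspace $T$ in $X^2$ means a linear subspace of $X^2$ (a linear relation); a linear operator in $X$ is identified with its graph. Notation: $D(T)=\{x:(x,f)\in T \text{ for some } f\}$, $T^{-1}=\{(f,x):(x,f)\in T\}$, $\lambda I$ is the graph of $x\mapsto\lambda x$. The adjoint is $T^*=\{(y,g)\in X^2:\langle g,x\rangle=\langle y,f\rangle \text{ for all }(x,f)\in T\}$; $T$ is self-adjoint if $T=T^*$. Resolvent set: $\rho(T)=\{\lambda\in\mathbb C:(\lambda I-T)^{-1}$ is a bounded linear operator defined on all of $X\}$; spectrum $\sigma(T)=\mathbb C\setminus\rho(T)$. A number $\lambda$ is an eigenvalue of $T$ if $(x,\lambda x)\in T$ for some $x\ne 0$, with multiplicity the dimension of $\{x:(x,\lambda x)\in T\}$. The essential spectrum $\sigma_e(T)$ is the set of points of $\sigma(T)$ that are either accumulation points of $\sigma(T)$ or isolated eigenvalues of infinite multiplicity. Compact perturbation: for closed subspaces $T,S$ in $X^2$ with orthogonal projections $P_T,P_S$ of $X^2$ onto $T$, $S$, $T$ is a compact perturbation of $S$ if $P_T-P_S$ is a compact operator. 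*)

theory Defs
  imports "HOL-Analysis.Analysis"
begin

text \<open>Complex Hilbert spaces. HOL-Analysis only provides real inner product spaces.
A complex Hilbert space is a real Hilbert space (class real_inner + complete_space)
equipped with a complex scalar multiplication extending the real one, such that
multiplication by the imaginary unit is orthogonal for the real inner product.
The complex inner product (linear in the first argument) is recovered as
cinner x y = inner x y + i * inner x (i y).\<close>

class complex_hilbert = real_inner + complete_space +
  fixes scaleC :: "complex \<Rightarrow> 'a \<Rightarrow> 'a"
  assumes scaleC_add_right: "scaleC a (x + y) = scaleC a x + scaleC a y"
    and scaleC_add_left: "scaleC (a + b) x = scaleC a x + scaleC b x"
    and scaleC_scaleC: "scaleC a (scaleC b x) = scaleC (a * b) x"
    and scaleC_of_real: "scaleC (complex_of_real r) x = scaleR r x"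
    and inner_scaleC_ii: "inner (scaleC \<i> x) (scaleC \<i> y) = inner x y"

definition cinner :: "'a::complex_hilbert \<Rightarrow> 'a \<Rightarrow> complex" where
  "cinner x y = Complex (inner x y) (inner x (scaleC \<i> y))"

text \<open>Linear relations (subspaces of X^2 = X \<times> X).  The Hilbert space structure of
X \<times> X is the product one (HOL-Analysis: inner (x,f) (y,g) = inner x y + inner f g).\<close>

definition lin_rel :: "('a::complex_hilbert \<times> 'a) set \<Rightarrow> bool" where
  "lin_rel T \<longleftrightarrow> (0, 0) \<in> T \<and>
     (\<forall>x f y g. (x, f) \<in> T \<longrightarrow> (y, g) \<in> T \<longrightarrow> (x + y, f + g) \<in> T) \<and>
     (\<forall>c x f. (x, f) \<in> T \<longrightarrow> (scaleC c x, scaleC c f) \<in> T)"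

definition adjoint_rel :: "('a::complex_hilbert \<times> 'a) set \<Rightarrow> ('a \<times> 'a) set" where
  "adjoint_rel T = {(y, g). \<forall>x f. (x, f) \<in> T \<longrightarrow> cinner g x = cinner y f}"

definition self_adjoint_rel :: "('a::complex_hilbert \<times> 'a) set \<Rightarrow> bool" where
  "self_adjoint_rel T \<longleftrightarrow> lin_rel T \<and> T = adjoint_rel T"

definition cbounded_linear :: "('a::complex_hilbert \<Rightarrow> 'a) \<Rightarrow> bool" where
  "cbounded_linear R \<longleftrightarrow> bounded_linear R \<and> (\<forall>c x. R (scaleC c x) = scaleC c (R x))"

text \<open>(\<lambda>I - T)^{-1} = {(\<lambda>x - f, x) | (x,f) \<in> T}; \<lambda> is in the resolvent set iff this
relation is the graph of a bounded (complex-)linear operator defined on all of X.\<close>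

definition resolvent_set :: "('a::complex_hilbert \<times> 'a) set \<Rightarrow> complex set" where
  "resolvent_set T = {l. \<exists>R. cbounded_linear R \<and>
      {(scaleC l x - f, x) | x f. (x, f) \<in> T} = {(u, R u) | u. True}}"

definition spectrum_rel :: "('a::complex_hilbert \<times> 'a) set \<Rightarrow> complex set" where
  "spectrum_rel T = UNIV - resolvent_set T"

definition eigenspace_rel :: "('a::complex_hilbert \<times> 'a) set \<Rightarrow> complex \<Rightarrow> 'a set" where
  "eigenspace_rel T l = {x. (x, scaleC l x) \<in> T}"

definition is_eigenvalue_rel :: "('a::complex_hilbert \<times> 'a) set \<Rightarrow> complex \<Rightarrow> bool" where
  "is_eigenvalue_rel T l \<longleftrightarrow> (\<exists>x. x \<noteq> 0 \<and> x \<in> eigenspace_rel T l)"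

definition infinite_cdim :: "'a::complex_hilbert set \<Rightarrow> bool" where
  "infinite_cdim E \<longleftrightarrow> (\<forall>n. \<exists>v :: nat \<Rightarrow> 'a. (\<forall>i<n. v i \<in> E) \<and>
      (\<forall>c :: nat \<Rightarrow> complex. (\<Sum>i<n. scaleC (c i) (v i)) = 0 \<longrightarrow> (\<forall>i<n. c i = 0)))"

definition ess_spectrum_rel :: "('a::complex_hilbert \<times> 'a) set \<Rightarrow> complex set" where
  "ess_spectrum_rel T = {l \<in> spectrum_rel T.
      l islimpt spectrum_rel T \<or>
      (\<not> l islimpt spectrum_rel T \<and> is_eigenvalue_rel T l \<and> infinite_cdim (eigenspace_rel T l))}"

definition orth_proj :: "('a::complex_hilbert \<times> 'a) set \<Rightarrow> 'a \<times> 'a \<Rightarrow> 'a \<times> 'a" where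
  "orth_proj T z = (THE p. p \<in> T \<and> (\<forall>w\<in>T. inner (z - p) w = 0))"

definition compact_operator :: "('b::real_normed_vector \<Rightarrow> 'b) \<Rightarrow> bool" where
  "compact_operator K \<longleftrightarrow> linear K \<and> (\<forall>B. bounded B \<longrightarrow> compact (closure (K ` B)))"

definition compact_perturbation ::
    "('a::complex_hilbert \<times> 'a) set \<Rightarrow> ('a \<times> 'a) set \<Rightarrow> bool" where
  "compact_perturbation T S \<longleftrightarrow> lin_rel T \<and> lin_rel S \<and> closed T \<and> closed S \<and>
     compact_operator (\<lambda>z. orth_proj T z - orth_proj S z)"

end

theory Submission
  imports Defs
begin

text \<open>Call \<open>T\<close> proper at a real \<open>l\<close> if bounded sequences \<open>x\<^sub>n\<close> with \<open>(x\<^sub>n, f\<^sub>n) \<in> T\<close> and \<open>f\<^sub>n - l x\<^sub>n\<close>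
  convergent have convergent subsequences. Properness is invariant under compact perturbations:
  for \<open>z\<^sub>n = (x\<^sub>n, f\<^sub>n)\<close> in \<open>T\<close> the points \<open>P\<^sub>S z\<^sub>n\<close> of \<open>S\<close> differ from \<open>z\<^sub>n = P\<^sub>T z\<^sub>n\<close> by a sequence with a
  convergent subsequence. The spectrum of a self-adjoint relation is real, and its essential
  spectrum consists of the real points at which the relation is not proper. The substantial half
  of this is that \<open>T - l\<close> is bounded below on the orthogonal complement of its kernel when \<open>l\<close> is an
  isolated spectral point; this uses only that the resolvent norm at a real point is at most the
  inverse distance to the spectrum, so no spectral theorem is needed.\<close>

section \<open>Projections and symmetric operators in real inner product spaces\<close>

lemma norm_minus_scaleR_power2:
  fixes v w :: "'b::real_inner"
  shows "(norm (v - t *\<^sub>R w))\<^sup>2 = (norm v)\<^sup>2 - 2 * t * inner v w + t * t * inner w w"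
  unfolding power2_norm_eq_inner by (simp add: algebra_simps inner_commute)

text \<open>A minimising sequence for the distance from \<open>z\<close> to \<open>S\<close> is
  Cauchy by the parallelogram law, and its limit is the foot of the perpendicular. Real
  orthogonality is used because \<open>orth_proj\<close> is defined with the real inner
  product.\<close>

lemma orthogonal_projection_exists:
  fixes S :: "'b::{real_inner,complete_space} set"
  assumes S: "subspace S" "closed S"
  shows "\<exists>p\<in>S. \<forall>w\<in>S. inner (z - p) w = 0"
proof -
  define d where "d = infdist z S"
  have ne: "S \<noteq> {}" using subspace_0[OF S(1)] by auto
  have dle: "d \<le> norm (z - w)" if "w \<in> S" for w
    using infdist_le[OF that, of z] by (simp add: d_def dist_norm)
  have d0: "d \<ge> 0" by (simp add: d_def infdist_nonneg)
  have "\<exists>p\<in>S. norm (z - p) < d + 1 / real (Suc n)" for n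
  proof (rule ccontr)
    assume "\<not> ?thesis"
    then have "d + 1 / real (Suc n) \<le> (INF a\<in>S. dist z a)"
      by (intro cINF_greatest ne) (auto simp: dist_norm not_less)
    then show False using ne by (simp add: d_def infdist_def field_simps)
  qed
  then obtain p where p: "\<And>n. p n \<in> S" "\<And>n. norm (z - p n) < d + 1 / real (Suc n)"
    by metis
  have lim: "(\<lambda>n. norm (z - p n)) \<longlonglongrightarrow> d"
  proof (rule tendsto_sandwich[OF _ _ tendsto_const])
    show "(\<lambda>n. d + 1 / real (Suc n)) \<longlonglongrightarrow> d"
      using tendsto_add[OF tendsto_const[of d] LIMSEQ_inverse_real_of_nat]
      by (simp add: inverse_eq_divide)
  qed (use dle p in \<open>auto intro!: always_eventually simp: less_imp_le\<close>)
  \<comment> \<open>Parallelogram law for \<open>z - p n\<close> and \<open>z - p m\<close>: the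
    midpoint of \<open>p n\<close> and \<open>p m\<close> lies in \<open>S\<close>, so its distance
    to \<open>z\<close> is at least \<open>d\<close>.\<close>
  have par: "(norm (p n - p m))\<^sup>2 \<le> 2 * (norm (z - p n))\<^sup>2 + 2 * (norm (z - p m))\<^sup>2 - 4 * d\<^sup>2" for n m
  proof -
    have "(1/2) *\<^sub>R (p n + p m) \<in> S"
      using S(1) p(1) by (simp add: subspace_add subspace_scale)
    from dle[OF this] have "d\<^sup>2 \<le> (norm (z - (1/2) *\<^sub>R (p n + p m)))\<^sup>2"
      using d0 by (simp add: power_mono)
    then show ?thesis
      by (simp add: power2_norm_eq_inner algebra_simps inner_commute)
  qed
  have "Cauchy p"
  proof (rule metric_CauchyI)
    fix e :: real assume e: "e > 0"
    have "(\<lambda>n. (norm (z - p n))\<^sup>2) \<longlonglongrightarrow> d\<^sup>2"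
      using lim by (rule tendsto_power)
    then have "\<forall>\<^sub>F n in sequentially. (norm (z - p n))\<^sup>2 < d\<^sup>2 + e\<^sup>2 / 4"
      using e by (intro order_tendstoD(2)) auto
    then obtain N where N: "\<And>n. n \<ge> N \<Longrightarrow> (norm (z - p n))\<^sup>2 < d\<^sup>2 + e\<^sup>2 / 4"
      by (auto simp: eventually_sequentially)
    have "dist (p m) (p n) < e" if "m \<ge> N" "n \<ge> N" for m n
    proof -
      have "(norm (p m - p n))\<^sup>2 < e\<^sup>2"
        using par[of m n] N[OF that(1)] N[OF that(2)] by linarith
      then show ?thesis using e by (simp add: dist_norm power_less_imp_less_base)
    qed
    then show "\<exists>M. \<forall>m\<ge>M. \<forall>n\<ge>M. dist (p m) (p n) < e" by blast
  qed
  then obtain q where q: "p \<longlonglongrightarrow> q" using Cauchy_convergent convergent_def by blast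
  have qS: "q \<in> S" using S(2) p(1) q closed_sequentially by blast
  have "(\<lambda>n. norm (z - p n)) \<longlonglongrightarrow> norm (z - q)"
    using q by (intro tendsto_intros)
  then have nq: "norm (z - q) = d" using lim LIMSEQ_unique by blast
  have "inner (z - q) w = 0" if w: "w \<in> S" for w
  proof (cases "w = 0")
    case False
    \<comment> \<open>This \<open>t\<close> minimises the quadratic
      \<open>norm (z - q - t w)^2\<close>. Since \<open>q\<close> is already nearest, moving along
      \<open>w\<close> cannot gain anything, so the inner product vanishes.\<close>
    define t where "t = inner (z - q) w / inner w w"
    have ww: "inner w w > 0" using False by simp
    have "q + t *\<^sub>R w \<in> S" using S(1) qS w by (simp add: subspace_add subspace_scale)
    from dle[OF this] have "(norm (z - q))\<^sup>2 \<le> (norm ((z - q) - t *\<^sub>R w))\<^sup>2"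
      using d0 by (simp add: nq power_mono diff_diff_eq)
    then have "2 * t * inner (z - q) w \<le> t * t * inner w w"
      using norm_minus_scaleR_power2[of "z - q" t w] by linarith
    moreover have "t * inner w w = inner (z - q) w" using ww by (simp add: t_def)
    ultimately have "t * inner (z - q) w \<le> 0" by (simp add: mult.assoc)
    then have "(inner (z - q) w)\<^sup>2 / inner w w \<le> 0" by (simp add: t_def power2_eq_square)
    then show ?thesis using ww by (simp add: divide_le_0_iff)
  qed simp
  with qS show ?thesis by blast
qed

text \<open>For a symmetric \<open>R\<close> of norm r > 0, one of r and -r is an approximate
  eigenvalue. Otherwise R^2 - r^2 = (R + r)(R - r) would be bounded below, and expanding its square
  would give a bound for \<open>R\<close> strictly smaller than r.\<close>

lemma symmetric_not_bounded_below:
  fixes R :: "'b::real_inner \<Rightarrow> 'b"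
  assumes R: "bounded_linear R" and sym: "\<And>u v. inner (R u) v = inner u (R v)"
    and r: "onorm R > 0" and k: "k > 0"
    and minus: "\<And>u. k * norm u \<le> norm (R u - onorm R *\<^sub>R u)"
    and plus: "\<And>u. k * norm u \<le> norm (R u + onorm R *\<^sub>R u)"
  shows False
proof -
  interpret R: bounded_linear R by fact
  define r where "r = onorm R"
  have r0: "r > 0" using assms r_def by simp
  have le: "norm (R u) \<le> r * norm u" for u unfolding r_def by (rule onorm[OF R])
  have key: "k^4 * (norm u)\<^sup>2 \<le> r\<^sup>2 * (r\<^sup>2 * (norm u)\<^sup>2 - (norm (R u))\<^sup>2)" for u
  proof -
    define w where "w = R u - r *\<^sub>R u"
    have "k * (k * norm u) \<le> k * norm w"
      using minus[of u] k by (simp add: w_def r_def)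
    also have "\<dots> \<le> norm (R w + r *\<^sub>R w)" using plus by (simp add: r_def)
    also have "R w + r *\<^sub>R w = R (R u) - (r*r) *\<^sub>R u"
      by (simp add: w_def R.diff R.scaleR algebra_simps)
    finally have "(k * (k * norm u))\<^sup>2 \<le> (norm (R (R u) - (r*r) *\<^sub>R u))\<^sup>2"
      using k by (intro power_mono) auto
    also have "\<dots> = (norm (R (R u)))\<^sup>2 - 2 * r\<^sup>2 * (norm (R u))\<^sup>2 + r\<^sup>2 * r\<^sup>2 * (norm u)\<^sup>2"
      unfolding power2_norm_eq_inner using sym[of u "R u"]
      by (simp add: power2_eq_square algebra_simps inner_commute)
    also have "\<dots> \<le> r\<^sup>2 * (norm (R u))\<^sup>2 - 2 * r\<^sup>2 * (norm (R u))\<^sup>2 + r\<^sup>2 * r\<^sup>2 * (norm u)\<^sup>2"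
      using power_mono[OF le[of "R u"], of 2] by (simp add: power_mult_distrib)
    finally show ?thesis by (simp add: algebra_simps power_mult_distrib flip: power_mult power_add)
  qed
  \<comment> \<open>This is \<open>key\<close> solved for \<open>norm (R u)^2\<close>. As
    \<open>s\<close> may be negative, the operator norm is compared with the square root of
    \<open>max s 0\<close>.\<close>
  define s where "s = r\<^sup>2 - k^4 / r\<^sup>2"
  have bd: "(norm (R u))\<^sup>2 \<le> s * (norm u)\<^sup>2" for u
    using key[of u] r0 by (simp add: s_def field_simps power2_eq_square)
  have "r \<le> sqrt (max s 0)" unfolding r_def
  proof (rule onorm_bound)
    fix u
    have "(norm (R u))\<^sup>2 \<le> (sqrt (max s 0) * norm u)\<^sup>2"
      using order.trans[OF bd[of u] mult_right_mono[of s "max s 0"]] by (simp add: power_mult_distrib)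
    then show "norm (R u) \<le> sqrt (max s 0) * norm u"
      by (rule power2_le_imp_le) simp
  qed simp
  then have "r\<^sup>2 \<le> max s 0" using r0 by (metis max.cobounded2 order_less_imp_le power_mono real_sqrt_pow2)
  moreover have "s < r\<^sup>2" using k r0 by (simp add: s_def)
  ultimately show False using r0 by (simp add: max_def split: if_splits)
qed

section \<open>Sequential compactness in finite-dimensional spans\<close>

definition seq_compact_balls :: "'b::real_normed_vector set \<Rightarrow> bool" where
  "seq_compact_balls V \<longleftrightarrow> (\<forall>x::nat \<Rightarrow> 'b. (\<forall>n. x n \<in> V) \<longrightarrow> Bseq x \<longrightarrow>
     (\<exists>r l. strict_mono r \<and> l \<in> V \<and> (x \<circ> r) \<longlonglongrightarrow> l))"

lemma seq_compact_balls_closed: "seq_compact_balls V \<Longrightarrow> closed V"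
  unfolding closed_sequential_limits seq_compact_balls_def
  by (metis LIMSEQ_subseq_LIMSEQ LIMSEQ_unique convergentI convergent_imp_Bseq)

text \<open>Induction on the spanning set. By induction \<open>span B\<close> is closed, so a new
  vector \<open>v\<close> outside it has positive distance \<open>d\<close> from it. This bounds the
  coefficient of \<open>v\<close> along a bounded sequence; first the coefficients and then the
  remainders in \<open>span B\<close> are made convergent.\<close>

lemma seq_compact_balls_span:
  assumes "finite B"
  shows "seq_compact_balls (span B)"
  using assms
proof (induction B)
  case empty
  show ?case unfolding seq_compact_balls_def
  proof (intro allI impI)
    fix x :: "nat \<Rightarrow> 'a" assume "\<forall>n. x n \<in> span {}"
    then have "x = (\<lambda>_. 0)" by auto
    then show "\<exists>r l. strict_mono r \<and> l \<in> span {} \<and> (x \<circ> r) \<longlonglongrightarrow> l"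
      by (intro exI[of _ id] exI[of _ 0]) (simp add: strict_mono_def o_def)
  qed
next
  case (insert v B)
  show ?case
  proof (cases "v \<in> span B")
    case True
    then show ?thesis using insert by (simp add: span_redundant)
  next
    case False
    have cl: "closed (span B)" by (rule seq_compact_balls_closed[OF insert.IH])
    define d where "d = infdist v (span B)"
    have d: "d > 0"
      using False cl span_zero[of B]
      by (metis d_def in_closed_iff_infdist_zero empty_iff infdist_nonneg less_eq_real_def)
    have coef: "\<bar>k\<bar> * d \<le> norm (w + k *\<^sub>R v)" if w: "w \<in> span B" for k w
    proof (cases "k = 0")
      case False
      have "(- inverse k) *\<^sub>R w \<in> span B" using w by (rule span_scale)
      then have "d \<le> norm (v - (- inverse k) *\<^sub>R w)"
        unfolding d_def dist_norm[symmetric] by (rule infdist_le)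
      then have "\<bar>k\<bar> * d \<le> norm (k *\<^sub>R (v - (- inverse k) *\<^sub>R w))"
        by (simp add: mult_left_mono)
      then show ?thesis using False by (simp add: algebra_simps)
    qed simp
    show ?thesis unfolding seq_compact_balls_def
    proof (intro allI impI)
      fix x :: "nat \<Rightarrow> 'a" assume x: "\<forall>n. x n \<in> span (insert v B)" and "Bseq x"
      then obtain M where M: "\<And>n. norm (x n) \<le> M" by (auto simp: Bseq_def)
      from x have "\<forall>n. \<exists>k. x n - k *\<^sub>R v \<in> span B" using span_breakdown_eq by blast
      then obtain k where k: "\<And>n. x n - k n *\<^sub>R v \<in> span B" by metis
      have kb: "\<bar>k n\<bar> \<le> M / d" for n
        using order.trans[OF coef[OF k[of n], of "k n"]] M[of n] d by (simp add: field_simps)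
      then have "bounded (range k)" by (auto simp: bounded_iff)
      then obtain k0 r1 where r1: "strict_mono r1" "(k \<circ> r1) \<longlonglongrightarrow> k0"
        using bounded_imp_convergent_subsequence by blast
      define w where "w = (\<lambda>n. x (r1 n) - k (r1 n) *\<^sub>R v)"
      have "norm (w n) \<le> M + M / d * norm v" for n
        unfolding w_def using M[of "r1 n"] mult_right_mono[OF kb[of "r1 n"], of "norm v"]
        by (intro norm_triangle_le_diff) simp
      then have "Bseq w" by (rule BseqI')
      moreover have "\<forall>n. w n \<in> span B" using k by (simp add: w_def)
      ultimately obtain r2 w0 where r2: "strict_mono r2" "w0 \<in> span B" "(w \<circ> r2) \<longlonglongrightarrow> w0"
        using insert.IH unfolding seq_compact_balls_def by blast
      have "(\<lambda>n. (w \<circ> r2) n + ((k \<circ> r1) \<circ> r2) n *\<^sub>R v) \<longlonglongrightarrow> w0 + k0 *\<^sub>R v"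
        by (intro tendsto_intros r2 LIMSEQ_subseq_LIMSEQ[OF r1(2) r2(1)])
      then have "(x \<circ> (r1 \<circ> r2)) \<longlonglongrightarrow> w0 + k0 *\<^sub>R v"
        by (simp add: w_def o_def)
      moreover have "w0 + k0 *\<^sub>R v \<in> span (insert v B)"
        using r2(2) by (auto simp: span_breakdown_eq intro: exI[of _ k0])
      ultimately show "\<exists>r l. strict_mono r \<and> l \<in> span (insert v B) \<and> (x \<circ> r) \<longlonglongrightarrow> l"
        using r1 r2 strict_mono_o by blast
    qed
  qed
qed

section \<open>Complex scalar multiplication through the real structure\<close>

lemma scaleC_one [simp]: "scaleC 1 (x::'a::complex_hilbert) = x"
  using scaleC_of_real[of 1 x] by simp

lemma scaleC_zero_left [simp]: "scaleC 0 (x::'a::complex_hilbert) = 0"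
  using scaleC_of_real[of 0 x] by simp

lemma scaleC_minus_one: "scaleC (-1) (x::'a::complex_hilbert) = - x"
  using scaleC_of_real[of "-1" x] by simp

lemma scaleC_zero_right [simp]: "scaleC c (0::'a::complex_hilbert) = 0"
  using scaleC_add_right[of c 0 0] by simp

lemma scaleC_minus_right: "scaleC c (- x) = - scaleC c (x::'a::complex_hilbert)"
  using scaleC_add_right[of c x "- x"] by (simp add: minus_unique)

lemma scaleC_diff_right: "scaleC c (x - y) = scaleC c x - scaleC c (y::'a::complex_hilbert)"
  using scaleC_add_right[of c x "- y"] by (simp add: scaleC_minus_right)

lemma scaleC_sum_right:
  "scaleC c (\<Sum>i\<in>A. v i) = (\<Sum>i\<in>A. scaleC c (v i :: 'a::complex_hilbert))"
  by (induction A rule: infinite_finite_induct) (auto simp: scaleC_add_right)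

lemma scaleC_eq_Re_Im:
  "scaleC c x = Re c *\<^sub>R x + Im c *\<^sub>R scaleC \<i> (x::'a::complex_hilbert)"
proof -
  have "scaleC c x = scaleC (of_real (Re c) + of_real (Im c) * \<i>) x"
    using complex_eq[of c] by (simp add: mult.commute)
  also have "\<dots> = Re c *\<^sub>R x + Im c *\<^sub>R scaleC \<i> x"
    by (simp only: scaleC_add_left scaleC_of_real flip: scaleC_scaleC)
  finally show ?thesis .
qed

lemma inner_scaleC_ii_left:
  "inner (scaleC \<i> x) y = - inner x (scaleC \<i> (y::'a::complex_hilbert))"
  using inner_scaleC_ii[of x "scaleC \<i> y"] by (simp add: scaleC_scaleC scaleC_minus_one)

lemma inner_scaleC_left:
  "inner (scaleC c x) y = inner x (scaleC (cnj c) (y::'a::complex_hilbert))"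
  by (simp add: scaleC_eq_Re_Im[of c] scaleC_eq_Re_Im[of "cnj c"] inner_simps inner_scaleC_ii_left)

lemma bounded_linear_scaleC: "bounded_linear (scaleC c :: 'a::complex_hilbert \<Rightarrow> 'a)"
proof (rule bounded_linear_intro[where K = "\<bar>Re c\<bar> + \<bar>Im c\<bar>"])
  fix x y :: 'a and r
  show "scaleC c (x + y) = scaleC c x + scaleC c y" by (rule scaleC_add_right)
  show "scaleC c (r *\<^sub>R x) = r *\<^sub>R scaleC c x"
    by (simp only: scaleC_scaleC mult.commute flip: scaleC_of_real)
  have "norm (scaleC \<i> x) = norm x" by (simp add: norm_eq_sqrt_inner inner_scaleC_ii)
  then show "norm (scaleC c x) \<le> norm x * (\<bar>Re c\<bar> + \<bar>Im c\<bar>)"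
    unfolding scaleC_eq_Re_Im[of c]
    by (intro norm_triangle_le) (simp add: algebra_simps)
qed

lemmas tendsto_scaleC = bounded_linear.tendsto[OF bounded_linear_scaleC]

section \<open>Complex dimension, real spans and orthonormal sequences\<close>

definition cindependent_family :: "nat \<Rightarrow> (nat \<Rightarrow> 'a::complex_hilbert) \<Rightarrow> bool" where
  "cindependent_family n v \<longleftrightarrow>
     (\<forall>c :: nat \<Rightarrow> complex. (\<Sum>i<n. scaleC (c i) (v i)) = 0 \<longrightarrow> (\<forall>i<n. c i = 0))"

lemma infinite_cdim_alt:
  "infinite_cdim E \<longleftrightarrow> (\<forall>n. \<exists>v. (\<forall>i<n. v i \<in> E) \<and> cindependent_family n v)"
  by (simp add: infinite_cdim_def cindependent_family_def)

text \<open>A linearly independent family in \<open>E\<close> of maximal length spans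
  \<open>E\<close> over the complex numbers. The real span therefore needs both \<open>v i\<close>
  and its multiple by the imaginary unit.\<close>

lemma finite_cdim_subset_span:
  assumes "\<not> infinite_cdim (E :: 'a::complex_hilbert set)"
  shows "\<exists>B. finite B \<and> E \<subseteq> span B"
proof -
  define P where "P n \<longleftrightarrow> (\<exists>v :: nat \<Rightarrow> 'a. (\<forall>i<n. v i \<in> E) \<and> cindependent_family n v)" for n
  have "P 0" by (simp add: P_def cindependent_family_def)
  moreover have "\<not> (\<forall>n. P n)" using assms by (simp add: infinite_cdim_alt P_def)
  ultimately obtain m where m: "P m" "\<not> P (Suc m)" using nat_induct[of P] by blast
  then obtain v where v: "\<And>i. i < m \<Longrightarrow> v i \<in> E" "cindependent_family m v"
    by (auto simp: P_def)
  define B where "B = v ` {..<m} \<union> (\<lambda>i. scaleC \<i> (v i)) ` {..<m}"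
  have "x \<in> span B" if x: "x \<in> E" for x
  proof -
    define v' where "v' = v(m := x)"
    have "\<forall>i<Suc m. v' i \<in> E" using v x by (simp add: v'_def less_Suc_eq)
    then have "\<not> cindependent_family (Suc m) v'" using m(2) by (auto simp: P_def)
    then obtain c where c: "(\<Sum>i<Suc m. scaleC (c i) (v' i)) = 0" "\<exists>i<Suc m. c i \<noteq> 0"
      by (auto simp: cindependent_family_def)
    have "(\<Sum>i<m. scaleC (c i) (v' i)) = (\<Sum>i<m. scaleC (c i) (v i))"
      by (intro sum.cong) (auto simp: v'_def)
    then have eq: "(\<Sum>i<m. scaleC (c i) (v i)) + scaleC (c m) x = 0"
      using c(1) by (simp add: v'_def)
    have cm: "c m \<noteq> 0"
    proof
      assume z: "c m = 0"
      then have "\<forall>i<m. c i = 0" using eq v(2) by (simp add: cindependent_family_def)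
      then show False using c(2) z less_Suc_eq by auto
    qed
    have "scaleC (c m) x = - (\<Sum>i<m. scaleC (c i) (v i))"
      using eq by (metis add.commute eq_neg_iff_add_eq_0)
    then have "scaleC (inverse (c m)) (scaleC (c m) x) =
        scaleC (inverse (c m)) (- (\<Sum>i<m. scaleC (c i) (v i)))"
      by simp
    then have "x = - (\<Sum>i<m. scaleC (inverse (c m) * c i) (v i))"
      using cm by (simp add: scaleC_scaleC scaleC_minus_right scaleC_sum_right)
    moreover have "scaleC a (v i) \<in> span B" if "i < m" for a i
      unfolding scaleC_eq_Re_Im[of a] using that
      by (intro span_add span_scale span_base) (auto simp: B_def)
    ultimately show ?thesis by (metis (no_types, lifting) lessThan_iff span_neg span_sum)
  qed
  moreover have "finite B" by (simp add: B_def)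
  ultimately show ?thesis by blast
qed

text \<open>Complex independence implies real independence, so \<open>card B + 1\<close> complex
  independent vectors in \<open>span B\<close> would contradict the real dimension bound.\<close>

lemma infinite_cdim_not_subset_span:
  assumes E: "infinite_cdim (E :: 'a::complex_hilbert set)" and B: "finite B"
  shows "\<not> E \<subseteq> span B"
proof
  assume sub: "E \<subseteq> span B"
  define n where "n = Suc (card B)"
  obtain v where v: "\<And>i. i < n \<Longrightarrow> v i \<in> E" "cindependent_family n v"
    using E unfolding infinite_cdim_alt by blast
  have real: "\<forall>i<n. c i = 0" if "(\<Sum>i<n. c i *\<^sub>R v i) = 0" for c :: "nat \<Rightarrow> real"
    using that v(2)[unfolded cindependent_family_def, rule_format, of "\<lambda>i. of_real (c i)"]
    by (simp add: scaleC_of_real)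
  have inj: "inj_on v {..<n}"
  proof (rule inj_onI, rule ccontr)
    fix i j assume ij: "i \<in> {..<n}" "j \<in> {..<n}" "v i = v j" "i \<noteq> j"
    \<comment> \<open>A repetition \<open>v i = v j\<close> gives the nontrivial relation
      \<open>v i - v j = 0\<close>.\<close>
    define c where "c k = (if k = i then 1 else if k = j then -1 else 0 :: real)" for k
    have "(\<Sum>k<n. c k *\<^sub>R v k) = (\<Sum>k\<in>{i,j}. c k *\<^sub>R v k)"
      using ij by (intro sum.mono_neutral_right) (auto simp: c_def)
    also have "\<dots> = 0" using ij by (simp add: c_def)
    finally have "c i = 0" using real ij by auto
    then show False by (simp add: c_def)
  qed
  have "independent (v ` {..<n})"
  proof (rule independent_if_scalars_zero)
    fix f x assume f: "(\<Sum>x\<in>v ` {..<n}. f x *\<^sub>R x) = 0" and x: "x \<in> v ` {..<n}"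
    have "(\<Sum>i<n. f (v i) *\<^sub>R v i) = 0" using f by (simp add: sum.reindex[OF inj])
    then show "f x = 0" using real[of "\<lambda>i. f (v i)"] x by auto
  qed simp
  moreover have "v ` {..<n} \<subseteq> span B" using v(1) sub by auto
  ultimately have "card (v ` {..<n}) \<le> card B"
    using independent_span_bound[OF B] by blast
  then show False using card_image[OF inj] by (simp add: n_def)
qed

text \<open>Gram-Schmidt: the vectors chosen so far have a closed span that misses some
  \<open>x\<close> in \<open>E\<close>, and the next vector is the normalised difference of
  \<open>x\<close> and its projection onto that span.\<close>

lemma infinite_cdim_orthonormal_sequence:
  fixes E :: "'a::complex_hilbert set"
  assumes E: "infinite_cdim E" and sub: "subspace E"
  obtains e :: "nat \<Rightarrow> 'a" where "\<And>n. e n \<in> E" "\<And>n. norm (e n) = 1"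
    "\<And>m n. m \<noteq> n \<Longrightarrow> inner (e m) (e n) = 0"
proof -
  have "\<exists>e :: nat \<Rightarrow> 'a. \<forall>n. e n \<in> E \<and> norm (e n) = 1 \<and> (\<forall>m<n. inner (e n) (e m) = 0)"
  proof (rule dependent_wellorder_choice)
    fix n and e :: "nat \<Rightarrow> 'a"
    assume e: "\<And>y. y < n \<Longrightarrow> e y \<in> E \<and> norm (e y) = 1 \<and> (\<forall>m<y. inner (e y) (e m) = 0)"
    let ?B = "e ` {..<n}"
    obtain x where x: "x \<in> E" "x \<notin> span ?B"
      using infinite_cdim_not_subset_span[OF E, of ?B] by auto
    have "closed (span ?B)" by (intro seq_compact_balls_closed seq_compact_balls_span) simp
    then obtain p where p: "p \<in> span ?B" "\<And>w. w \<in> span ?B \<Longrightarrow> inner (x - p) w = 0"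
      using orthogonal_projection_exists[OF subspace_span] by metis
    have "?B \<subseteq> E" using e by auto
    then have "p \<in> E" using p(1) sub span_minimal by blast
    then have "x - p \<in> E" using x(1) sub by (simp add: subspace_diff)
    moreover have "x - p \<noteq> 0" using x(2) p(1) by auto
    moreover have "inner (x - p) (e m) = 0" if "m < n" for m
      using p(2) that by (simp add: span_base)
    ultimately show "\<exists>r. r \<in> E \<and> norm r = 1 \<and> (\<forall>m<n. inner r (e m) = 0)"
      using sub by (intro exI[of _ "(1 / norm (x - p)) *\<^sub>R (x - p)"]) (auto intro: subspace_scale)
  qed auto
  then obtain e :: "nat \<Rightarrow> 'a" where
    e: "\<And>n. e n \<in> E" "\<And>n. norm (e n) = 1" "\<And>m n. m < n \<Longrightarrow> inner (e n) (e m) = 0"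
    by blast
  have "inner (e m) (e n) = 0" if "m \<noteq> n" for m n
    using e(3)[of m n] e(3)[of n m] that by (cases m n rule: linorder_cases) (auto simp: inner_commute)
  with e show ?thesis by (intro that)
qed

text \<open>Distinct members of an orthonormal sequence have squared distance 2, so no subsequence
  is Cauchy.\<close>

lemma orthonormal_subseq_not_convergent:
  fixes e :: "nat \<Rightarrow> 'b::real_inner"
  assumes "\<And>n. norm (e n) = 1" "\<And>m n. m \<noteq> n \<Longrightarrow> inner (e m) (e n) = 0" "strict_mono r"
  shows "\<not> convergent (\<lambda>n. e (r n))"
proof
  assume "convergent (\<lambda>n. e (r n))"
  then have "Cauchy (\<lambda>n. e (r n))" by (rule convergent_Cauchy)
  then obtain M where M: "\<And>m n. m \<ge> M \<Longrightarrow> n \<ge> M \<Longrightarrow> dist (e (r m)) (e (r n)) < 1"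
    by (metis Cauchy_def zero_less_one)
  have "r M \<noteq> r (Suc M)" using assms(3) by (simp add: strict_mono_eq)
  then have o: "inner (e (r M)) (e (r (Suc M))) = 0" using assms(2) by blast
  have "(norm (e (r M) - e (r (Suc M))))\<^sup>2 = 2"
    using norm_minus_scaleR_power2[of "e (r M)" 1 "e (r (Suc M))"] o assms(1)[of "r M"] assms(1)[of "r (Suc M)"]
    by (simp flip: power2_norm_eq_inner)
  moreover have "(norm (e (r M) - e (r (Suc M))))\<^sup>2 < 1\<^sup>2"
    using M[of M "Suc M"] by (intro power_strict_mono) (auto simp: dist_norm)
  ultimately show False by simp
qed

section \<open>Self-adjoint relations, their resolvent set and real spectrum\<close>

lemma lin_rel_subspace: "lin_rel T \<Longrightarrow> subspace T"
  unfolding lin_rel_def subspace_def by (auto simp: zero_prod_def simp flip: scaleC_of_real)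

context
  fixes T :: "('a::complex_hilbert \<times> 'a) set"
  assumes sa: "self_adjoint_rel T"
begin

lemma self_adjoint_scaleC: "(x, f) \<in> T \<Longrightarrow> (scaleC c x, scaleC c f) \<in> T"
  using sa unfolding self_adjoint_rel_def lin_rel_def by blast

lemma self_adjoint_subspace: "subspace T"
  using sa unfolding self_adjoint_rel_def by (blast intro: lin_rel_subspace)

text \<open>This reduces self-adjointness to the real inner product: \<open>T\<close> is invariant
  under the imaginary unit, so the imaginary part of the adjoint identity for a pair is its real
  part for the rotated pair.\<close>

lemma self_adjoint_mem_iff:
  "(y, g) \<in> T \<longleftrightarrow> (\<forall>x f. (x, f) \<in> T \<longrightarrow> inner g x = inner y f)"
proof -
  have "(y, g) \<in> T \<longleftrightarrow> (\<forall>x f. (x, f) \<in> T \<longrightarrow> cinner g x = cinner y f)"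
    using sa unfolding self_adjoint_rel_def adjoint_rel_def by blast
  also have "\<dots> \<longleftrightarrow> (\<forall>x f. (x, f) \<in> T \<longrightarrow> inner g x = inner y f)"
  proof (intro iffI allI impI)
    fix x f assume *: "\<forall>x f. (x, f) \<in> T \<longrightarrow> cinner g x = cinner y f" "(x, f) \<in> T"
    then have "cinner g x = cinner y f" by blast
    then show "inner g x = inner y f" by (simp add: cinner_def)
  next
    fix x f assume *: "\<forall>x f. (x, f) \<in> T \<longrightarrow> inner g x = inner y f" "(x, f) \<in> T"
    then have "inner g x = inner y f" "inner g (scaleC \<i> x) = inner y (scaleC \<i> f)"
      using self_adjoint_scaleC[of x f \<i>] by blast+
    then show "cinner g x = cinner y f" by (simp add: cinner_def)
  qed
  finally show ?thesis .
qed

lemma self_adjoint_symmetric: "(x, f) \<in> T \<Longrightarrow> (y, g) \<in> T \<Longrightarrow> inner f y = inner x g"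
  using self_adjoint_mem_iff by (metis inner_commute)

lemma self_adjoint_diff: "(x, f) \<in> T \<Longrightarrow> (y, g) \<in> T \<Longrightarrow> (x - y, f - g) \<in> T"
  using subspace_diff[OF self_adjoint_subspace] by fastforce

lemma self_adjoint_add: "(x, f) \<in> T \<Longrightarrow> (y, g) \<in> T \<Longrightarrow> (x + y, f + g) \<in> T"
  using subspace_add[OF self_adjoint_subspace] by fastforce

lemma self_adjoint_scaleR: "(x, f) \<in> T \<Longrightarrow> (r *\<^sub>R x, r *\<^sub>R f) \<in> T"
  using self_adjoint_scaleC[of x f "of_real r"] by (simp add: scaleC_of_real)

lemma self_adjoint_closed: "closed T"
proof -
  let ?A = "\<Inter>z\<in>T. {w. inner (snd w) (fst z) = inner (fst w) (snd z)}"
  have "?A = T"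
  proof (intro set_eqI iffI)
    fix w assume "w \<in> ?A"
    then have "(fst w, snd w) \<in> T" by (subst self_adjoint_mem_iff) force
    then show "w \<in> T" by simp
  next
    fix w assume "w \<in> T"
    then show "w \<in> ?A" using self_adjoint_symmetric[of "fst w" "snd w"] by simp
  qed
  moreover have "closed ?A"
    by (intro closed_INT ballI closed_Collect_eq continuous_intros)
  ultimately show ?thesis by (rule subst)
qed

text \<open>The orthogonal complement of the range of l - T lies in the kernel of its adjoint cnj l
  - T. Moving \<open>l\<close> across the inner product turns the hypothesis into the criterion
  \<open>self_adjoint_mem_iff\<close>.\<close>

lemma self_adjoint_orthogonal_range:
  assumes "\<And>x f. (x, f) \<in> T \<Longrightarrow> inner v (scaleC l x - f) = 0"
  shows "(v, scaleC (cnj l) v) \<in> T"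
  by (subst self_adjoint_mem_iff) (use assms in \<open>simp add: inner_scaleC_left inner_diff_right\<close>)

text \<open>The bound at \<open>l\<close> makes the inverse single-valued and bounded and, with
  \<open>T\<close> closed, the range closed. The bound at \<open>cnj l\<close> makes the orthogonal
  complement of the range trivial, so the range is everything.\<close>

lemma in_resolvent_setI:
  assumes c: "c > 0"
    and below: "\<And>x f. (x, f) \<in> T \<Longrightarrow> c * norm x \<le> norm (scaleC l x - f)"
    and below': "\<And>x f. (x, f) \<in> T \<Longrightarrow> c * norm x \<le> norm (scaleC (cnj l) x - f)"
  shows "l \<in> resolvent_set T"
proof -
  define h where "h = (\<lambda>z :: 'a \<times> 'a. scaleC l (fst z) - snd z)"
  have h: "bounded_linear h" unfolding h_def
    by (intro bounded_linear_sub bounded_linear_compose[OF bounded_linear_scaleC]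
        bounded_linear_fst bounded_linear_snd)
  have sub: "subspace (h ` T)"
    using h bounded_linear.linear linear_subspace_image self_adjoint_subspace by blast
  have cl: "closed (h ` T)" unfolding closed_sequential_limits
  proof (intro allI impI, elim conjE)
    fix y u assume "\<forall>n. y n \<in> h ` T" and lim: "y \<longlonglongrightarrow> u"
    then have "\<forall>n. \<exists>x f. (x, f) \<in> T \<and> y n = scaleC l x - f" by (fastforce simp: h_def)
    then obtain x f where xf: "\<And>n. (x n, f n) \<in> T" "\<And>n. y n = scaleC l (x n) - f n" by metis
    have "Cauchy x"
    proof (rule metric_CauchyI)
      fix e :: real assume e: "e > 0"
      have "Cauchy y" using lim by (rule LIMSEQ_imp_Cauchy)
      then obtain M where M: "\<And>m n. m \<ge> M \<Longrightarrow> n \<ge> M \<Longrightarrow> dist (y m) (y n) < c * e"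
        using c e by (metis Cauchy_def mult_pos_pos)
      have "dist (x m) (x n) < e" if "m \<ge> M" "n \<ge> M" for m n
      proof -
        have "c * norm (x m - x n) \<le> norm (y m - y n)"
          using below[OF self_adjoint_diff[OF xf(1)[of m] xf(1)[of n]]]
          by (simp add: xf(2) scaleC_diff_right algebra_simps)
        also have "\<dots> < c * e" using M[OF that] by (simp add: dist_norm)
        finally show ?thesis using c by (simp add: dist_norm)
      qed
      then show "\<exists>M. \<forall>m\<ge>M. \<forall>n\<ge>M. dist (x m) (x n) < e" by blast
    qed
    then obtain x0 where x0: "x \<longlonglongrightarrow> x0" using Cauchy_convergent convergent_def by blast
    have "(\<lambda>n. scaleC l (x n) - y n) \<longlonglongrightarrow> scaleC l x0 - u"
      by (intro tendsto_diff tendsto_scaleC x0 lim)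
    then have "f \<longlonglongrightarrow> scaleC l x0 - u" by (simp add: xf(2))
    then have lim': "(\<lambda>n. (x n, f n)) \<longlonglongrightarrow> (x0, scaleC l x0 - u)"
      by (rule tendsto_Pair[OF x0])
    have "(x0, scaleC l x0 - u) \<in> T"
      by (rule closed_sequentially[OF self_adjoint_closed _ lim']) (simp add: xf(1))
    then show "u \<in> h ` T" by (force simp: h_def)
  qed
  have surj: "\<exists>x. (x, scaleC l x - u) \<in> T" for u
  proof -
    obtain p where p: "p \<in> h ` T" "\<And>w. w \<in> h ` T \<Longrightarrow> inner (u - p) w = 0"
      using orthogonal_projection_exists[OF sub cl] by metis
    \<comment> \<open>The residual of the projection of \<open>u\<close> onto the range is in the
      kernel at \<open>cnj l\<close>, where \<open>below'\<close> forces it to vanish.\<close>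
    have "(u - p, scaleC (cnj l) (u - p)) \<in> T"
      using p(2) by (intro self_adjoint_orthogonal_range) (force simp: h_def)
    from below'[OF this] have "u = p" using c by (simp add: mult_le_0_iff)
    with p(1) obtain x f where "(x, f) \<in> T" "u = scaleC l x - f" by (fastforce simp: h_def)
    then show ?thesis by (intro exI[of _ x]) simp
  qed
  then obtain R where R: "\<And>u. (R u, scaleC l (R u) - u) \<in> T" by metis
  have uniq: "R (scaleC l x - f) = x" if "(x, f) \<in> T" for x f
    using below[OF self_adjoint_diff[OF R[of "scaleC l x - f"] that]] c
    by (simp add: scaleC_diff_right mult_le_0_iff)
  have "R (u + v) = R u + R v" for u v
    using uniq[OF self_adjoint_add[OF R[of u] R[of v]]] by (simp add: scaleC_add_right algebra_simps)
  moreover have hom: "R (scaleC a u) = scaleC a (R u)" for a u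
    using uniq[OF self_adjoint_scaleC[OF R[of u], of a]]
    by (simp add: scaleC_scaleC scaleC_diff_right mult.commute)
  moreover have "R (r *\<^sub>R u) = r *\<^sub>R R u" for r u
    using hom[of "of_real r" u] by (simp add: scaleC_of_real)
  moreover have "norm (R u) \<le> norm u * (1 / c)" for u
    using below[OF R[of u]] c by (simp add: field_simps)
  ultimately have "cbounded_linear R"
    unfolding cbounded_linear_def using bounded_linear_intro[of R "1 / c"] by blast
  moreover have "{(scaleC l x - f, x) | x f. (x, f) \<in> T} = {(u, R u) | u. True}"
  proof safe
    fix x f assume "(x, f) \<in> T"
    then show "\<exists>u. (scaleC l x - f, x) = (u, R u) \<and> True" using uniq by auto
  next
    fix u
    show "\<exists>x f. (u, R u) = (scaleC l x - f, x) \<and> (x, f) \<in> T"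
      using R[of u] by (intro exI[of _ "R u"] exI[of _ "scaleC l (R u) - u"]) simp
  qed
  ultimately show ?thesis unfolding resolvent_set_def by blast
qed

lemma resolvent_setE:
  assumes "l \<in> resolvent_set T"
  obtains R where "bounded_linear R" "\<And>u. (R u, scaleC l (R u) - u) \<in> T"
    "\<And>x f. (x, f) \<in> T \<Longrightarrow> R (scaleC l x - f) = x"
proof -
  from assms obtain R where R: "cbounded_linear R"
    "{(scaleC l x - f, x) | x f. (x, f) \<in> T} = {(u, R u) | u. True}"
    unfolding resolvent_set_def by blast
  show ?thesis
  proof (rule that)
    show "bounded_linear R" using R(1) by (simp add: cbounded_linear_def)
    fix u
    have "(u, R u) \<in> {(scaleC l x - f, x) | x f. (x, f) \<in> T}" using R(2) by blast
    then obtain x f where "u = scaleC l x - f" "R u = x" "(x, f) \<in> T" by blast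
    then show "(R u, scaleC l (R u) - u) \<in> T" by simp
  next
    fix x f assume "(x, f) \<in> T"
    then have "(scaleC l x - f, x) \<in> {(u, R u) | u. True}" using R(2) by blast
    then show "R (scaleC l x - f) = x" by simp
  qed
qed

lemma resolvent_set_bounded_below:
  assumes "l \<in> resolvent_set T"
  obtains c where "c > 0" "\<And>x f. (x, f) \<in> T \<Longrightarrow> c * norm x \<le> norm (scaleC l x - f)"
proof -
  obtain R where R: "bounded_linear R" "\<And>x f. (x, f) \<in> T \<Longrightarrow> R (scaleC l x - f) = x"
    using resolvent_setE[OF assms] by metis
  obtain K where K: "K > 0" "\<And>u. norm (R u) \<le> norm u * K"
    using bounded_linear.pos_bounded[OF R(1)] by blast
  show ?thesis
  proof (rule that[of "1 / K"])
    fix x f assume "(x, f) \<in> T"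
    then show "1 / K * norm x \<le> norm (scaleC l x - f)"
      using K(2)[of "scaleC l x - f"] R(2) K(1) by (simp add: field_simps)
  qed (use K in auto)
qed

text \<open>A real point is its own conjugate, so a single lower bound supplies both hypotheses of
  \<open>in_resolvent_setI\<close>.\<close>

lemma resolvent_set_of_real_iff:
  "of_real l \<in> resolvent_set T \<longleftrightarrow>
     (\<exists>c>0. \<forall>x f. (x, f) \<in> T \<longrightarrow> c * norm x \<le> norm (f - l *\<^sub>R x))"
proof
  assume "of_real l \<in> resolvent_set T"
  then obtain c where "c > 0"
    "\<And>x f. (x, f) \<in> T \<Longrightarrow> c * norm x \<le> norm (scaleC (of_real l) x - f)"
    using resolvent_set_bounded_below by blast
  then show "\<exists>c>0. \<forall>x f. (x, f) \<in> T \<longrightarrow> c * norm x \<le> norm (f - l *\<^sub>R x)"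
    by (intro exI[of _ c]) (simp add: scaleC_of_real norm_minus_commute)
next
  assume "\<exists>c>0. \<forall>x f. (x, f) \<in> T \<longrightarrow> c * norm x \<le> norm (f - l *\<^sub>R x)"
  then show "of_real l \<in> resolvent_set T"
    by (auto intro!: in_resolvent_setI simp: scaleC_of_real norm_minus_commute)
qed

text \<open>By symmetry of \<open>T\<close>, the vectors \<open>f - Re l x\<close> and i x are
  orthogonal for the real inner product. Up to sign, \<open>scaleC l x - f\<close> is the difference
  of the first and \<open>Im l\<close> times the second, so Pythagoras applies.\<close>

lemma self_adjoint_norm_nonreal:
  assumes "(x, f) \<in> T"
  shows "\<bar>Im l\<bar> * norm x \<le> norm (scaleC l x - f)"
proof -
  have "inner f (scaleC \<i> x) = 0"
    using self_adjoint_symmetric[OF assms self_adjoint_scaleC[OF assms, of \<i>]]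
      inner_scaleC_ii_left[of x f] by (simp add: inner_commute)
  moreover have "inner x (scaleC \<i> x) = 0"
    using inner_scaleC_ii_left[of x x] by (simp add: inner_commute)
  ultimately have o: "inner (f - Re l *\<^sub>R x) (scaleC \<i> x) = 0" by (simp add: inner_simps)
  have "norm (scaleC l x - f) = norm ((f - Re l *\<^sub>R x) - Im l *\<^sub>R scaleC \<i> x)"
    by (subst norm_minus_commute) (simp add: scaleC_eq_Re_Im[of l] diff_diff_eq)
  then have "(norm (scaleC l x - f))\<^sup>2 = (norm (f - Re l *\<^sub>R x))\<^sup>2 + Im l * Im l * inner x x"
    using norm_minus_scaleR_power2[of "f - Re l *\<^sub>R x" "Im l" "scaleC \<i> x"] o
    by (simp add: inner_scaleC_ii)
  then have "(\<bar>Im l\<bar> * norm x)\<^sup>2 \<le> (norm (scaleC l x - f))\<^sup>2"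
    by (simp add: power_mult_distrib power2_norm_eq_inner[of x] power2_eq_square[of "Im l"])
  then show ?thesis by (rule power2_le_imp_le) simp
qed

lemma spectrum_self_adjoint_real:
  assumes "l \<in> spectrum_rel T"
  shows "l = of_real (Re l)"
proof (rule ccontr)
  assume "l \<noteq> of_real (Re l)"
  then have "\<bar>Im l\<bar> > 0" by (auto simp: complex_eq_iff)
  then have "l \<in> resolvent_set T"
    using self_adjoint_norm_nonreal[of _ _ l] self_adjoint_norm_nonreal[of _ _ "cnj l"]
    by (intro in_resolvent_setI[of "\<bar>Im l\<bar>"]) auto
  then show False using assms by (simp add: spectrum_rel_def)
qed

lemma eigenspace_of_real: "eigenspace_rel T (of_real l) = {x. (x, l *\<^sub>R x) \<in> T}"
  by (simp add: eigenspace_rel_def scaleC_of_real)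

lemma subspace_eigenspace: "subspace (eigenspace_rel T (of_real l))"
  unfolding eigenspace_of_real subspace_def
proof (intro conjI ballI allI)
  show "0 \<in> {x. (x, l *\<^sub>R x) \<in> T}"
    using subspace_0[OF self_adjoint_subspace] by (simp add: zero_prod_def)
next
  fix x y assume "x \<in> {x. (x, l *\<^sub>R x) \<in> T}" "y \<in> {x. (x, l *\<^sub>R x) \<in> T}"
  then show "x + y \<in> {x. (x, l *\<^sub>R x) \<in> T}"
    using self_adjoint_add[of x "l *\<^sub>R x" y "l *\<^sub>R y"] by (simp add: scaleR_add_right)
next
  fix r x assume "x \<in> {x. (x, l *\<^sub>R x) \<in> T}"
  then show "r *\<^sub>R x \<in> {x. (x, l *\<^sub>R x) \<in> T}"
    using self_adjoint_scaleR[of x "l *\<^sub>R x" r] by (simp add: mult.commute)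
qed

lemma closed_eigenspace: "closed (eigenspace_rel T (of_real l))"
  unfolding eigenspace_of_real
proof -
  have "closed ((\<lambda>x. (x, l *\<^sub>R x)) -` T)"
    by (intro continuous_closed_vimage self_adjoint_closed) (intro continuous_intros)
  then show "closed {x. (x, l *\<^sub>R x) \<in> T}" by (simp add: vimage_def)
qed

end

section \<open>Lower bounds at resolvent points and at isolated spectral points\<close>

lemma subspace_closure:
  fixes G :: "'b::real_normed_vector set"
  assumes G: "subspace G"
  shows "subspace (closure G)"
  unfolding subspace_def
proof (intro conjI ballI allI)
  show "0 \<in> closure G" using subspace_0[OF G] closure_subset by blast
next
  fix x y assume "x \<in> closure G" "y \<in> closure G"
  then obtain u v where "\<forall>n. u n \<in> G" "u \<longlonglongrightarrow> x" "\<forall>n. v n \<in> G" "v \<longlonglongrightarrow> y"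
    unfolding closure_sequential by blast
  then show "x + y \<in> closure G"
    unfolding closure_sequential
    by (intro exI[of _ "\<lambda>n. u n + v n"]) (auto intro: subspace_add[OF G] tendsto_add)
next
  fix a x assume "x \<in> closure G"
  then obtain u where "\<forall>n. u n \<in> G" "u \<longlonglongrightarrow> x" unfolding closure_sequential by blast
  then show "a *\<^sub>R x \<in> closure G"
    unfolding closure_sequential
    by (intro exI[of _ "\<lambda>n. a *\<^sub>R u n"]) (auto intro: subspace_scale[OF G] tendsto_scaleR)
qed

context
  fixes T :: "('a::complex_hilbert \<times> 'a) set"
  assumes sa: "self_adjoint_rel T"
begin

text \<open>If the resolvent \<open>R\<close> at \<open>\<mu>\<close> had norm r > 1/m, both points
  \<open>\<mu>\<close> + 1/r and \<open>\<mu>\<close> - 1/r would lie in the resolvent set. Then R +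
  r and R - r would both be bounded below, contradicting
  \<open>symmetric_not_bounded_below\<close>.\<close>

lemma resolvent_distance:
  assumes mu: "of_real \<mu> \<in> resolvent_set T"
    and gap: "\<And>c. 0 < \<bar>c\<bar> \<Longrightarrow> \<bar>c\<bar> < m \<Longrightarrow> of_real (\<mu> + c) \<in> resolvent_set T"
    and xf: "(x, f) \<in> T"
  shows "m * norm x \<le> norm (f - \<mu> *\<^sub>R x)"
proof (rule ccontr)
  assume "\<not> ?thesis"
  then have lt: "norm (f - \<mu> *\<^sub>R x) < m * norm x" by simp
  obtain R where bl: "bounded_linear R"
    and RT: "\<And>u. (R u, \<mu> *\<^sub>R R u - u) \<in> T"
    and R: "\<And>x f. (x, f) \<in> T \<Longrightarrow> R (\<mu> *\<^sub>R x - f) = x"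
    using resolvent_setE[OF sa mu] by (auto simp: scaleC_of_real)
  define r where "r = onorm R"
  have xpos: "norm x > 0" using lt by (cases "x = 0") auto
  have "norm x \<le> r * norm (f - \<mu> *\<^sub>R x)"
    using onorm[OF bl, of "\<mu> *\<^sub>R x - f"] R[OF xf] by (simp add: r_def norm_minus_commute)
  moreover have "r \<ge> 0" unfolding r_def by (rule onorm_pos_le[OF bl])
  ultimately have r: "r > 0" using xpos by (cases "r = 0") auto
  then have "norm x < r * (m * norm x)"
    using \<open>norm x \<le> _\<close> mult_strict_left_mono[OF lt r] by linarith
  then have rm: "1 < r * m" using xpos by (simp add: mult.assoc[symmetric])
  define c where "c = 1 / r"
  have c: "c > 0" "c < m" "c * r = 1" using r rm by (auto simp: c_def field_simps)
  have below: "\<exists>k>0. \<forall>u. k * norm u \<le> norm (R u + (s * r) *\<^sub>R u)" if s: "\<bar>s\<bar> = 1" for s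
  proof -
    have "of_real (\<mu> + s * c) \<in> resolvent_set T" using c s by (intro gap) (auto simp: abs_mult)
    then obtain k where k: "k > 0"
      "\<And>x f. (x, f) \<in> T \<Longrightarrow> k * norm x \<le> norm (f - (\<mu> + s * c) *\<^sub>R x)"
      using resolvent_set_of_real_iff[OF sa] by blast
    have ss: "s * s = 1" using s by (metis abs_mult_self_eq mult_1)
    \<comment> \<open>Write \<open>u\<close> as (u + s c R u) - s c R u. The lower bound at
      \<open>\<mu> + s * c\<close> controls \<open>R u\<close> by the first term, which itself
      equals s c (R u + s r u) because \<open>c * r = 1\<close>.\<close>
    have "norm u \<le> ((1 + c / k) * c) * norm (R u + (s * r) *\<^sub>R u)" for u
    proof -
      have "u + (s * c) *\<^sub>R R u = (s * c) *\<^sub>R (R u + (s * r) *\<^sub>R u)"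
        using c(3) ss by (simp add: algebra_simps)
      then have n: "norm (u + (s * c) *\<^sub>R R u) = c * norm (R u + (s * r) *\<^sub>R u)"
        using c s by (simp add: abs_mult)
      have "\<mu> *\<^sub>R R u - u - (\<mu> + s * c) *\<^sub>R R u = - (u + (s * c) *\<^sub>R R u)"
        by (simp add: algebra_simps)
      then have "k * norm (R u) \<le> norm (u + (s * c) *\<^sub>R R u)"
        using k(2)[OF RT[of u]] by (simp only: norm_minus_cancel)
      then have "c * norm (R u) \<le> c / k * norm (u + (s * c) *\<^sub>R R u)"
        using k c by (simp add: field_simps)
      moreover have "norm u \<le> norm (u + (s * c) *\<^sub>R R u) + c * norm (R u)"
        using norm_triangle_ineq4[of "u + (s * c) *\<^sub>R R u" "(s * c) *\<^sub>R R u"] s c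
        by (simp add: abs_mult)
      ultimately have "norm u \<le> (1 + c / k) * norm (u + (s * c) *\<^sub>R R u)"
        by (simp add: algebra_simps)
      then show ?thesis by (simp add: n mult.assoc)
    qed
    moreover have "(1 + c / k) * c > 0" using c k by (simp add: add_pos_pos)
    ultimately show ?thesis
      by (intro exI[of _ "1 / ((1 + c / k) * c)"]) (simp add: field_simps)
  qed
  obtain k1 where k1: "k1 > 0" "\<And>u. k1 * norm u \<le> norm (R u + r *\<^sub>R u)"
    using below[of 1] by auto
  obtain k2 where k2: "k2 > 0" "\<And>u. k2 * norm u \<le> norm (R u - r *\<^sub>R u)"
    using below[of "-1"] by auto
  show False
  proof (rule symmetric_not_bounded_below[OF bl, of "min k1 k2"])
    \<comment> \<open>Symmetry of \<open>T\<close> on the pairs (R u, \<open>\<mu>\<close> R u - u)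
      and (R v, \<open>\<mu>\<close> R v - v): the terms with \<open>\<mu>\<close> cancel.\<close>
    show "inner (R u) v = inner u (R v)" for u v :: 'a
      using self_adjoint_symmetric[OF sa RT[of u] RT[of v]] by (simp add: inner_simps)
    fix u :: 'a
    have "min k1 k2 * norm u \<le> k1 * norm u" "min k1 k2 * norm u \<le> k2 * norm u"
      by (simp_all add: mult_right_mono)
    then show "min k1 k2 * norm u \<le> norm (R u + onorm R *\<^sub>R u)"
      "min k1 k2 * norm u \<le> norm (R u - onorm R *\<^sub>R u)"
      using k1(2)[of u] k2(2)[of u] by (simp_all add: r_def)
  qed (use r k1 k2 in \<open>simp_all add: r_def\<close>)
qed

text \<open>Project \<open>x\<close> onto the closed range. The residual \<open>x - p\<close> is an
  eigenvector at \<open>l\<close> or zero, hence orthogonal to \<open>x\<close>; it is also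
  orthogonal to \<open>p\<close>, hence to itself.\<close>

lemma orthogonal_eigenspace_in_closure_range:
  assumes perp: "\<And>y. (y, l *\<^sub>R y) \<in> T \<Longrightarrow> inner x y = 0"
  shows "x \<in> closure ((\<lambda>z. snd z - l *\<^sub>R fst z) ` T)" (is "x \<in> closure ?G")
proof -
  have "linear (\<lambda>z :: 'a \<times> 'a. snd z - l *\<^sub>R fst z)"
    by (intro linearI) (auto simp: algebra_simps)
  then have "subspace ?G" using self_adjoint_subspace[OF sa] linear_subspace_image by blast
  then have "subspace (closure ?G)" by (rule subspace_closure)
  then obtain p where p: "p \<in> closure ?G" "\<And>w. w \<in> closure ?G \<Longrightarrow> inner (x - p) w = 0"
    using orthogonal_projection_exists[OF _ closed_closure, of ?G x] by blast
  have orth: "inner (x - p) (scaleC (of_real l) y - g) = 0" if "(y, g) \<in> T" for y g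
  proof -
    have "g - l *\<^sub>R y \<in> ?G" using imageI[OF that, of "\<lambda>z. snd z - l *\<^sub>R fst z"] by simp
    then have "g - l *\<^sub>R y \<in> closure ?G" by (rule subsetD[OF closure_subset])
    then have "inner (x - p) (g - l *\<^sub>R y) = 0" by (rule p(2))
    moreover have "scaleC (of_real l) y - g = - (g - l *\<^sub>R y)" by (simp add: scaleC_of_real)
    ultimately show ?thesis by (simp only: inner_minus_right minus_zero)
  qed
  have "(x - p, scaleC (cnj (of_real l)) (x - p)) \<in> T"
    by (rule self_adjoint_orthogonal_range[OF sa]) (rule orth)
  then have "(x - p, l *\<^sub>R (x - p)) \<in> T" by (simp only: complex_cnj_complex_of_real scaleC_of_real)
  then have "inner x (x - p) = 0" by (rule perp)
  moreover have "inner p (x - p) = 0" using p(2)[OF p(1)] by (subst inner_commute)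
  ultimately have "inner (x - p) (x - p) = 0" by (subst inner_diff_left) simp
  then show ?thesis using p(1) by simp
qed

text \<open>At \<open>\<mu> = l \<plusminus> m\<close> the nearest spectral point is at distance at least \<open>m\<close>; squaring
  \<open>\<parallel>f - \<mu> x\<parallel> \<ge> m \<parallel>x\<parallel>\<close> bounds the quadratic form of \<open>T - l\<close> by \<open>\<parallel>(T - l) x\<parallel>\<^sup>2 / 2m\<close>,
  and polarisation turns this into a lower bound for \<open>T - l\<close> on the closure of its range.\<close>

lemma isolated_bounded_below:
  assumes m: "m > 0"
    and gap: "\<And>\<nu>. 0 < \<bar>\<nu> - l\<bar> \<Longrightarrow> \<bar>\<nu> - l\<bar> < 2 * m \<Longrightarrow> of_real \<nu> \<in> resolvent_set T"
    and xf: "(x, f) \<in> T"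
    and perp: "\<And>y. (y, l *\<^sub>R y) \<in> T \<Longrightarrow> inner x y = 0"
  shows "2 * m * norm x \<le> norm (f - l *\<^sub>R x)"
proof -
  have diag: "\<bar>2 * m * inner (f - l *\<^sub>R x) x\<bar> \<le> (norm (f - l *\<^sub>R x))\<^sup>2" if "(x, f) \<in> T" for x f
  proof -
    have "2 * s * inner (f - l *\<^sub>R x) x \<le> (norm (f - l *\<^sub>R x))\<^sup>2" if s: "\<bar>s\<bar> = m" for s
    proof -
      have "m * norm x \<le> norm (f - (l + s) *\<^sub>R x)"
        using s m by (intro resolvent_distance gap \<open>(x, f) \<in> T\<close>) auto
      also have "f - (l + s) *\<^sub>R x = (f - l *\<^sub>R x) - s *\<^sub>R x" by (simp add: algebra_simps)
      finally have "(m * norm x)\<^sup>2 \<le> (norm ((f - l *\<^sub>R x) - s *\<^sub>R x))\<^sup>2"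
        using m by (intro power_mono) auto
      moreover have "(m * norm x)\<^sup>2 = s * s * inner x x"
        using s by (auto simp: power_mult_distrib power2_norm_eq_inner power2_eq_square[of m])
      ultimately show ?thesis using norm_minus_scaleR_power2[of "f - l *\<^sub>R x" s x] by linarith
    qed
    from this[of m] this[of "-m"] m show ?thesis by (simp add: abs_le_iff)
  qed
  define g where "g = f - l *\<^sub>R x"
  have sym: "inner g y = inner x g'" if "(y, h) \<in> T" "g' = h - l *\<^sub>R y" for y h g'
    using self_adjoint_symmetric[OF sa xf that(1)] by (simp add: g_def that(2) inner_simps)
  have polar: "2 * m * inner x g' \<le> norm g * norm g'" if yh: "(y, h) \<in> T" "g' = h - l *\<^sub>R y" for y h g'
  proof (cases "g = 0 \<or> g' = 0")
    case True
    then show ?thesis using sym[OF yh] by auto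
  next
    case False
    \<comment> \<open>Rescaling \<open>y\<close> so that \<open>t * norm g' = norm g\<close>
      balances the two squares of the parallelogram identity, turning their sum into a multiple of
      \<open>norm g * norm g'\<close>.\<close>
    define t where "t = norm g / norm g'"
    have t: "t > 0" "t * norm g' = norm g" using False by (auto simp: t_def)
    note ty = self_adjoint_scaleR[OF sa yh(1), of t]
    have "2 * m * inner (g + t *\<^sub>R g') (x + t *\<^sub>R y) \<le> (norm (g + t *\<^sub>R g'))\<^sup>2"
      using diag[OF self_adjoint_add[OF sa xf ty]]
      by (simp add: g_def yh(2) algebra_simps abs_le_iff)
    moreover have "- (2 * m * inner (g - t *\<^sub>R g') (x - t *\<^sub>R y)) \<le> (norm (g - t *\<^sub>R g'))\<^sup>2"
      using diag[OF self_adjoint_diff[OF sa xf ty]]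
      by (simp add: g_def yh(2) algebra_simps abs_le_iff)
    moreover have "(norm (g + t *\<^sub>R g'))\<^sup>2 + (norm (g - t *\<^sub>R g'))\<^sup>2 = 2 * (norm g)\<^sup>2 + 2 * (t * norm g')\<^sup>2"
      unfolding power_mult_distrib power2_norm_eq_inner
      by (simp add: algebra_simps power2_eq_square)
    moreover have "inner (g + t *\<^sub>R g') (x + t *\<^sub>R y) - inner (g - t *\<^sub>R g') (x - t *\<^sub>R y) = 4 * t * inner x g'"
      using sym[OF yh] by (simp add: algebra_simps inner_commute)
    then have "2 * m * inner (g + t *\<^sub>R g') (x + t *\<^sub>R y) - 2 * m * inner (g - t *\<^sub>R g') (x - t *\<^sub>R y)
        = 2 * m * (4 * t * inner x g')"
      by (simp only: right_diff_distrib[symmetric])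
    ultimately have "2 * m * (4 * t * inner x g') \<le> 4 * (t * norm g') * norm g"
      unfolding t(2) power2_eq_square by linarith
    then have "(4 * t) * (2 * m * inner x g') \<le> (4 * t) * (norm g * norm g')"
      by (simp add: mult_ac)
    then show ?thesis using t(1) by (subst (asm) mult_le_cancel_left_pos) auto
  qed
  let ?G = "(\<lambda>z. snd z - l *\<^sub>R fst z) ` T"
  \<comment> \<open>The polarised bound survives limits in its second argument. As \<open>x\<close>
    is itself in the closed range, it may be inserted there.\<close>
  have "closure ?G \<subseteq> {w. 2 * m * inner x w \<le> norm g * norm w}"
  proof (rule closure_minimal)
    show "?G \<subseteq> {w. 2 * m * inner x w \<le> norm g * norm w}" using polar by fastforce
    show "closed {w. 2 * m * inner x w \<le> norm g * norm w}"
      by (intro closed_Collect_le continuous_intros)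
  qed
  then have "2 * m * inner x x \<le> norm g * norm x"
    using orthogonal_eigenspace_in_closure_range[OF perp] by blast
  then have "norm x * (2 * m * norm x) \<le> norm x * norm g"
    by (simp add: mult_ac power2_eq_square flip: power2_norm_eq_inner)
  then show ?thesis by (cases "x = 0") (auto simp: g_def)
qed

end

section \<open>Properness and the essential spectrum\<close>

text \<open>Failure of this condition is a form of Weyl's criterion by singular sequences. For
  closed \<open>T\<close> it says that T - l has finite-dimensional kernel and closed range.\<close>

definition proper_at :: "('a::complex_hilbert \<times> 'a) set \<Rightarrow> real \<Rightarrow> bool" where
  "proper_at T l \<longleftrightarrow> (\<forall>x f. (\<forall>n. (x n, f n) \<in> T) \<longrightarrow> Bseq x \<longrightarrow>
     convergent (\<lambda>n::nat. f n - l *\<^sub>R x n) \<longrightarrow> (\<exists>r. strict_mono r \<and> convergent (\<lambda>n. x (r n))))"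

text \<open>An orthonormal sequence of eigenvectors has residual zero but no convergent
  subsequence.\<close>

lemma proper_at_not_infinite_cdim:
  fixes T :: "('a::complex_hilbert \<times> 'a) set"
  assumes sa: "self_adjoint_rel T" and pr: "proper_at T l"
  shows "\<not> infinite_cdim (eigenspace_rel T (of_real l))"
proof
  assume "infinite_cdim (eigenspace_rel T (of_real l))"
  then obtain e :: "nat \<Rightarrow> 'a" where e: "\<And>n. e n \<in> eigenspace_rel T (of_real l)" "\<And>n. norm (e n) = 1"
    "\<And>m n. m \<noteq> n \<Longrightarrow> inner (e m) (e n) = 0"
    by (rule infinite_cdim_orthonormal_sequence[OF _ subspace_eigenspace[OF sa]]) blast
  have "Bseq e" by (rule BseqI'[of _ 1]) (simp add: e)
  moreover have "\<forall>n. (e n, l *\<^sub>R e n) \<in> T" using e(1) eigenspace_of_real[OF sa] by auto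
  moreover have "convergent (\<lambda>n. l *\<^sub>R e n - l *\<^sub>R e n)" by (simp add: convergent_const)
  ultimately obtain r where r: "strict_mono r" "convergent (\<lambda>n. e (r n))"
    using pr[unfolded proper_at_def, rule_format, of e "\<lambda>n. l *\<^sub>R e n"] by blast
  then show False using orthonormal_subseq_not_convergent[of e r] e by blast
qed

lemma spectrum_approximate_eigenvector:
  assumes sa: "self_adjoint_rel T" and "of_real \<mu> \<in> spectrum_rel T" and c: "c > 0"
  obtains x f where "(x, f) \<in> T" "norm x = 1" "norm (f - \<mu> *\<^sub>R x) < c"
proof -
  have "\<not> (\<exists>c>0. \<forall>x f. (x, f) \<in> T \<longrightarrow> c * norm x \<le> norm (f - \<mu> *\<^sub>R x))"
    using assms(2) resolvent_set_of_real_iff[OF sa] by (simp add: spectrum_rel_def)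
  then obtain x f where xf: "(x, f) \<in> T" "norm (f - \<mu> *\<^sub>R x) < c * norm x"
    using c by (meson not_le)
  then have x: "norm x > 0" by (cases "x = 0") auto
  let ?a = "1 / norm x"
  have "?a *\<^sub>R f - \<mu> *\<^sub>R (?a *\<^sub>R x) = ?a *\<^sub>R (f - \<mu> *\<^sub>R x)"
    by (simp add: algebra_simps)
  then have "norm (?a *\<^sub>R f - \<mu> *\<^sub>R (?a *\<^sub>R x)) = norm (f - \<mu> *\<^sub>R x) / norm x"
    by simp
  also have "\<dots> < c" using xf(2) x by (simp add: pos_divide_less_eq)
  finally have "norm (?a *\<^sub>R f - \<mu> *\<^sub>R (?a *\<^sub>R x)) < c" .
  then show ?thesis
    using that[OF self_adjoint_scaleR[OF sa xf(1), of ?a]] x by simp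
qed

text \<open>Approximate eigenvectors at \<open>\<mu>\<^sub>k \<rightarrow> l\<close> with error \<open>o(\<bar>\<mu>\<^sub>k - l\<bar>)\<close> are asymptotically
  orthogonal to the eigenspace at \<open>l\<close>, yet properness makes them accumulate in it.\<close>

lemma proper_at_not_islimpt:
  fixes T :: "('a::complex_hilbert \<times> 'a) set"
  assumes sa: "self_adjoint_rel T" and pr: "proper_at T l"
  shows "\<not> of_real l islimpt spectrum_rel T"
proof
  assume lp: "of_real l islimpt spectrum_rel T"
  have "\<exists>x f \<mu>. (x, f) \<in> T \<and> norm x = 1 \<and> \<mu> \<noteq> l \<and> \<bar>\<mu> - l\<bar> < 1 / real (Suc k) \<and>
      norm (f - \<mu> *\<^sub>R x) < \<bar>\<mu> - l\<bar> / real (Suc k)" for k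
  proof -
    obtain w where w: "w \<in> spectrum_rel T" "w \<noteq> of_real l" "dist w (of_real l) < 1 / real (Suc k)"
      using lp unfolding islimpt_approachable by (metis of_nat_0_less_iff zero_less_Suc zero_less_divide_1_iff)
    define \<mu> where "\<mu> = Re w"
    have wm: "w = of_real \<mu>" unfolding \<mu>_def by (rule spectrum_self_adjoint_real[OF sa w(1)])
    have ne: "\<mu> \<noteq> l" "\<bar>\<mu> - l\<bar> < 1 / real (Suc k)"
      using w(2,3) by (auto simp: wm dist_norm simp flip: of_real_diff)
    then show ?thesis
      using spectrum_approximate_eigenvector[OF sa w(1)[unfolded wm], of "\<bar>\<mu> - l\<bar> / real (Suc k)"]
      by (metis divide_pos_pos of_nat_0_less_iff right_minus_eq zero_less_Suc zero_less_abs_iff)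
  qed
  then obtain x f \<mu> where xf: "\<And>k. (x k, f k) \<in> T" and x1: "\<And>k. norm (x k) = 1"
    and ne: "\<And>k. \<mu> k \<noteq> l" and dl: "\<And>k. \<bar>\<mu> k - l\<bar> < 1 / real (Suc k)"
    and ap: "\<And>k. norm (f k - \<mu> k *\<^sub>R x k) < \<bar>\<mu> k - l\<bar> / real (Suc k)"
    by metis
  have inv0: "(\<lambda>k. 1 / real (Suc k)) \<longlonglongrightarrow> 0"
    using LIMSEQ_inverse_real_of_nat by (simp add: inverse_eq_divide)
  \<comment> \<open>The residual at \<open>l\<close> is at most the residual at
    \<open>\<mu> k\<close> plus the shift of the spectral parameter, and both tend to zero.\<close>
  have h0: "(\<lambda>k. f k - l *\<^sub>R x k) \<longlonglongrightarrow> 0"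
  proof (rule Lim_null_comparison)
    show "(\<lambda>k. 2 * (1 / real (Suc k))) \<longlonglongrightarrow> 0" using tendsto_mult_right_zero[OF inv0] .
    have "norm (f k - l *\<^sub>R x k) \<le> 2 * (1 / real (Suc k))" for k
    proof -
      have "norm (f k - l *\<^sub>R x k) = norm ((f k - \<mu> k *\<^sub>R x k) + (\<mu> k - l) *\<^sub>R x k)"
        by (simp add: algebra_simps)
      also have "\<dots> \<le> norm (f k - \<mu> k *\<^sub>R x k) + \<bar>\<mu> k - l\<bar>"
        using norm_triangle_ineq[of "f k - \<mu> k *\<^sub>R x k" "(\<mu> k - l) *\<^sub>R x k"] by (simp add: x1)
      finally have "norm (f k - l *\<^sub>R x k) \<le> norm (f k - \<mu> k *\<^sub>R x k) + \<bar>\<mu> k - l\<bar>" .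
      moreover have "\<bar>\<mu> k - l\<bar> / real (Suc k) \<le> \<bar>\<mu> k - l\<bar> / 1"
        by (intro divide_left_mono) auto
      ultimately show ?thesis using ap[of k] dl[of k] by (simp only: div_by_1)
    qed
    then show "\<forall>\<^sub>F k in sequentially. norm (f k - l *\<^sub>R x k) \<le> 2 * (1 / real (Suc k))" by simp
  qed
  have "Bseq x" by (rule BseqI'[of _ 1]) (simp add: x1)
  then obtain r where r: "strict_mono r" "convergent (\<lambda>n. x (r n))"
    using pr xf convergentI[OF h0] unfolding proper_at_def by blast
  then obtain x0 where x0: "(\<lambda>n. x (r n)) \<longlonglongrightarrow> x0" by (auto simp: convergent_def)
  have hr: "(\<lambda>n. f (r n) - l *\<^sub>R x (r n)) \<longlonglongrightarrow> 0"
    using LIMSEQ_subseq_LIMSEQ[OF h0 r(1)] by (simp add: o_def)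
  have "(\<lambda>n. (f (r n) - l *\<^sub>R x (r n)) + l *\<^sub>R x (r n)) \<longlonglongrightarrow> 0 + l *\<^sub>R x0"
    by (intro tendsto_add hr tendsto_scaleR tendsto_const x0)
  then have "(\<lambda>n. f (r n)) \<longlonglongrightarrow> l *\<^sub>R x0" by simp
  then have lim: "(\<lambda>n. (x (r n), f (r n))) \<longlonglongrightarrow> (x0, l *\<^sub>R x0)"
    by (rule tendsto_Pair[OF x0])
  have T0: "(x0, l *\<^sub>R x0) \<in> T"
    by (rule closed_sequentially[OF self_adjoint_closed[OF sa] _ lim]) (simp add: xf)
  have n0: "norm x0 = 1"
    using tendsto_norm[OF x0] LIMSEQ_unique[OF _ tendsto_const[of 1]] by (simp add: x1)
  \<comment> \<open>Pairing the residual at \<open>\<mu> k\<close> with the limit eigenvector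
    \<open>x0\<close> gives \<open>(l - \<mu> k) * inner (x k) x0\<close>. Dividing by the shift
    explains why the error had to be small relative to it.\<close>
  have small: "\<bar>inner (x k) x0\<bar> \<le> 1 / real (Suc k)" for k
  proof -
    have "inner (f k - \<mu> k *\<^sub>R x k) x0 = (l - \<mu> k) * inner (x k) x0"
      using self_adjoint_symmetric[OF sa xf[of k] T0] by (simp add: inner_simps algebra_simps)
    then have "\<bar>\<mu> k - l\<bar> * \<bar>inner (x k) x0\<bar> = \<bar>inner (f k - \<mu> k *\<^sub>R x k) x0\<bar>"
      by (simp add: abs_mult abs_minus_commute)
    also have "\<dots> \<le> norm (f k - \<mu> k *\<^sub>R x k)"
      using Cauchy_Schwarz_ineq2[of "f k - \<mu> k *\<^sub>R x k" x0] by (simp add: n0)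
    also have "\<dots> \<le> \<bar>\<mu> k - l\<bar> * (1 / real (Suc k))" using ap[of k] by simp
    finally show ?thesis using ne[of k] by (subst (asm) mult_le_cancel_left_pos) auto
  qed
  have in0: "(\<lambda>k. inner (x k) x0) \<longlonglongrightarrow> 0"
    by (rule Lim_null_comparison[OF _ inv0]) (use small in simp)
  have "(\<lambda>n. inner (x (r n)) x0) \<longlonglongrightarrow> 0"
    using LIMSEQ_subseq_LIMSEQ[OF in0 r(1)] by (simp add: o_def)
  moreover have "(\<lambda>n. inner (x (r n)) x0) \<longlonglongrightarrow> inner x0 x0"
    by (intro tendsto_inner x0 tendsto_const)
  ultimately have "inner x0 x0 = 0" using LIMSEQ_unique by blast
  then show False using n0 by simp
qed

text \<open>Split \<open>x n\<close> into its projection \<open>y n\<close> onto the eigenspace and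
  the rest. The lower bound makes the rest Cauchy, and the bounded \<open>y n\<close> subconverge in
  a finite-dimensional span.\<close>

lemma proper_atI:
  fixes T :: "('a::complex_hilbert \<times> 'a) set"
  assumes sa: "self_adjoint_rel T"
    and B: "finite B" "eigenspace_rel T (of_real l) \<subseteq> span B"
    and c: "c > 0"
    and below: "\<And>x f. (x, f) \<in> T \<Longrightarrow> (\<And>y. (y, l *\<^sub>R y) \<in> T \<Longrightarrow> inner x y = 0) \<Longrightarrow>
      c * norm x \<le> norm (f - l *\<^sub>R x)"
  shows "proper_at T l"
  unfolding proper_at_def
proof (intro allI impI)
  fix x f :: "nat \<Rightarrow> 'a"
  assume xf: "\<forall>n. (x n, f n) \<in> T" and bx: "Bseq x" and conv: "convergent (\<lambda>n. f n - l *\<^sub>R x n)"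
  let ?N = "eigenspace_rel T (of_real l)"
  have "\<forall>n. \<exists>p\<in>?N. \<forall>w\<in>?N. inner (x n - p) w = 0"
    using orthogonal_projection_exists[OF subspace_eigenspace[OF sa] closed_eigenspace[OF sa]] by blast
  then obtain y where y: "\<And>n. y n \<in> ?N" "\<And>n w. w \<in> ?N \<Longrightarrow> inner (x n - y n) w = 0" by metis
  define h where "h n = f n - l *\<^sub>R x n" for n
  \<comment> \<open>Subtracting the eigenpair \<open>(y n, l y n)\<close> leaves the residual
    \<open>f n - l x n\<close> unchanged.\<close>
  have wT: "(x n - y n, f n - l *\<^sub>R y n) \<in> T" for n
    using self_adjoint_diff[OF sa, of "x n" "f n" "y n" "l *\<^sub>R y n"] xf y(1)[of n] eigenspace_of_real[OF sa]
    by auto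
  have "Cauchy (\<lambda>n. x n - y n)"
  proof (rule metric_CauchyI)
    fix e :: real assume e: "e > 0"
    have "Cauchy h" using conv convergent_Cauchy unfolding h_def by blast
    then obtain M where M: "\<And>m n. m \<ge> M \<Longrightarrow> n \<ge> M \<Longrightarrow> dist (h m) (h n) < c * e"
      using c e by (metis Cauchy_def mult_pos_pos)
    have "dist (x m - y m) (x n - y n) < e" if "m \<ge> M" "n \<ge> M" for m n
    proof -
      have "c * norm ((x m - y m) - (x n - y n)) \<le>
          norm (((f m - l *\<^sub>R y m) - (f n - l *\<^sub>R y n)) - l *\<^sub>R ((x m - y m) - (x n - y n)))"
      proof (rule below[OF self_adjoint_diff[OF sa wT wT]])
        fix v assume "(v, l *\<^sub>R v) \<in> T"
        then have "v \<in> ?N" using eigenspace_of_real[OF sa] by simp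
        then show "inner ((x m - y m) - (x n - y n)) v = 0"
          using y(2)[of v m] y(2)[of v n] by (simp only: inner_diff_left[of "x m - y m"])
      qed
      also have "((f m - l *\<^sub>R y m) - (f n - l *\<^sub>R y n)) - l *\<^sub>R ((x m - y m) - (x n - y n)) = h m - h n"
        by (simp add: h_def algebra_simps)
      also have "norm (h m - h n) < c * e" using M[OF that] by (simp add: dist_norm)
      finally show ?thesis using c by (simp add: dist_norm)
    qed
    then show "\<exists>M. \<forall>m\<ge>M. \<forall>n\<ge>M. dist (x m - y m) (x n - y n) < e" by blast
  qed
  then obtain w0 where w0: "(\<lambda>n. x n - y n) \<longlonglongrightarrow> w0" using Cauchy_convergent convergent_def by blast
  have "Bseq (\<lambda>n. x n - y n)" using w0 convergentI convergent_imp_Bseq by blast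
  then obtain K1 where K1: "\<And>n. norm (x n - y n) \<le> K1" by (auto simp: Bseq_def)
  obtain K2 where K2: "\<And>n. norm (x n) \<le> K2" using bx by (auto simp: Bseq_def)
  have "norm (y n) \<le> K2 + K1" for n
    using norm_triangle_ineq4[of "x n" "x n - y n"] K1[of n] K2[of n] by simp
  then have "Bseq y" by (rule BseqI')
  moreover have "\<forall>n. y n \<in> span B" using y(1) B(2) by blast
  ultimately obtain r y0 where r: "strict_mono r" "(y \<circ> r) \<longlonglongrightarrow> y0"
    using seq_compact_balls_span[OF B(1)] unfolding seq_compact_balls_def by blast
  have "(\<lambda>n. (y \<circ> r) n + ((\<lambda>n. x n - y n) \<circ> r) n) \<longlonglongrightarrow> y0 + w0"
    by (intro tendsto_add r(2) LIMSEQ_subseq_LIMSEQ[OF w0 r(1)])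
  then have "convergent (\<lambda>n. x (r n))" by (simp add: convergentI)
  then show "\<exists>r. strict_mono r \<and> convergent (\<lambda>n. x (r n))" using r(1) by blast
qed

lemma of_real_ess_spectrum_iff:
  fixes T :: "('a::complex_hilbert \<times> 'a) set"
  assumes sa: "self_adjoint_rel T"
  shows "of_real l \<in> ess_spectrum_rel T \<longleftrightarrow> \<not> proper_at T l"
proof
  assume "of_real l \<in> ess_spectrum_rel T"
  then show "\<not> proper_at T l"
    using proper_at_not_islimpt[OF sa] proper_at_not_infinite_cdim[OF sa]
    by (auto simp: ess_spectrum_rel_def)
next
  assume np: "\<not> proper_at T l"
  show "of_real l \<in> ess_spectrum_rel T"
  proof (rule ccontr)
    assume ne: "of_real l \<notin> ess_spectrum_rel T"
    let ?N = "eigenspace_rel T (of_real l)"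
    show False
    proof (cases "of_real l \<in> resolvent_set T")
      case True
      then obtain c where c: "c > 0" "\<And>x f. (x, f) \<in> T \<Longrightarrow> c * norm x \<le> norm (f - l *\<^sub>R x)"
        using resolvent_set_of_real_iff[OF sa] by blast
      have "?N \<subseteq> span {}"
        using c(2) c(1) by (auto simp: eigenspace_of_real[OF sa] mult_le_0_iff dest: c(2))
      then show False using proper_atI[OF sa _ _ c(1)] c(2) np by blast
    next
      case False
      then have sp: "of_real l \<in> spectrum_rel T" by (simp add: spectrum_rel_def)
      then have nl: "\<not> of_real l islimpt spectrum_rel T" using ne by (auto simp: ess_spectrum_rel_def)
      have "\<exists>B. finite B \<and> ?N \<subseteq> span B"
      proof (cases "is_eigenvalue_rel T (of_real l)")
        case True
        then show ?thesis using ne nl sp finite_cdim_subset_span by (auto simp: ess_spectrum_rel_def)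
      next
        case False
        \<comment> \<open>A spectral point that is no eigenvalue is treated as one with
          zero-dimensional eigenspace.\<close>
        then have "?N \<subseteq> span {}" by (auto simp: is_eigenvalue_rel_def)
        then show ?thesis by blast
      qed
      then obtain B where B: "finite B" "?N \<subseteq> span B" by blast
      from nl obtain e where e: "e > 0"
        "\<And>w. w \<in> spectrum_rel T \<Longrightarrow> w \<noteq> of_real l \<Longrightarrow> \<not> dist w (of_real l) < e"
        unfolding islimpt_approachable by blast
      have "of_real \<nu> \<in> resolvent_set T" if "0 < \<bar>\<nu> - l\<bar>" "\<bar>\<nu> - l\<bar> < 2 * (e / 2)" for \<nu>
        using e(2)[of "of_real \<nu>"] that
        by (auto simp: spectrum_rel_def dist_norm simp flip: of_real_diff)
      then have "2 * (e / 2) * norm x \<le> norm (f - l *\<^sub>R x)"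
        if "(x, f) \<in> T" "\<And>y. (y, l *\<^sub>R y) \<in> T \<Longrightarrow> inner x y = 0" for x f
        using e(1) that by (intro isolated_bounded_below[OF sa]) auto
      then have "proper_at T l" using e(1) by (intro proper_atI[OF sa B, of "2 * (e / 2)"]) auto
      then show False using np by blast
    qed
  qed
qed

section \<open>Compact perturbations and invariance of properness\<close>

lemma orth_proj_eqI:
  assumes "lin_rel S" "p \<in> S" "\<And>w. w \<in> S \<Longrightarrow> inner (z - p) w = 0"
  shows "orth_proj S z = p"
  unfolding orth_proj_def
proof (rule the_equality)
  fix q assume q: "q \<in> S \<and> (\<forall>w\<in>S. inner (z - q) w = 0)"
  then have "p - q \<in> S" using assms lin_rel_subspace subspace_diff by blast
  then have "inner (z - q) (p - q) - inner (z - p) (p - q) = 0" using q assms by simp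
  then have "inner (p - q) (p - q) = 0" by (simp flip: inner_diff_left)
  then show "q = p" by simp
qed (use assms in auto)

lemma orth_proj_mem:
  assumes "lin_rel S" "closed S"
  shows "orth_proj S z \<in> S"
proof -
  obtain p where "p \<in> S" "\<And>w. w \<in> S \<Longrightarrow> inner (z - p) w = 0"
    using orthogonal_projection_exists[OF lin_rel_subspace] assms by metis
  then show ?thesis using orth_proj_eqI assms by metis
qed

text \<open>The difference of projections changes sign, and negation preserves compactness. This
  lets \<open>proper_at_compact_perturbation\<close> be used in both directions.\<close>

lemma compact_perturbation_sym:
  assumes "compact_perturbation T S"
  shows "compact_perturbation S T"
proof -
  let ?K = "\<lambda>z. orth_proj T z - orth_proj S z"
  have K: "linear ?K" "\<And>B. bounded B \<Longrightarrow> compact (closure (?K ` B))"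
    using assms by (auto simp: compact_perturbation_def compact_operator_def)
  have eq: "(\<lambda>z. orth_proj S z - orth_proj T z) = (\<lambda>z. - ?K z)" by auto
  have "compact (closure ((\<lambda>z. - ?K z) ` B))" if "bounded B" for B
  proof -
    let ?C = "uminus ` closure (?K ` B)"
    have C: "compact ?C" by (rule compact_negations[OF K(2)[OF that]])
    have "(\<lambda>z. - ?K z) ` B \<subseteq> ?C" using closure_subset[of "?K ` B"] by blast
    then have "closure ((\<lambda>z. - ?K z) ` B) \<subseteq> ?C" using C compact_imp_closed closure_minimal by blast
    then show ?thesis using compact_Int_closed[OF C closed_closure[of "(\<lambda>z. - ?K z) ` B"]]
      by (simp add: Int_absorb1)
  qed
  moreover have "linear (\<lambda>z. - ?K z)" using K(1) by (rule linear_compose_neg)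
  ultimately show ?thesis
    using assms unfolding compact_perturbation_def compact_operator_def eq by blast
qed

lemma proper_at_compact_perturbation:
  fixes T S :: "('a::complex_hilbert \<times> 'a) set"
  assumes cp: "compact_perturbation T S" and pr: "proper_at S l"
  shows "proper_at T l"
  unfolding proper_at_def
proof (intro allI impI)
  fix x f :: "nat \<Rightarrow> 'a"
  assume xf: "\<forall>n. (x n, f n) \<in> T" and bx: "Bseq x" and conv: "convergent (\<lambda>n. f n - l *\<^sub>R x n)"
  have T: "lin_rel T" and S: "lin_rel S" "closed S"
    and K: "compact_operator (\<lambda>z. orth_proj T z - orth_proj S z)"
    using cp by (auto simp: compact_perturbation_def)
  define z where "z n = (x n, f n)" for n
  define k where "k n = orth_proj T (z n) - orth_proj S (z n)" for n
  have "Bseq (\<lambda>n. f n - l *\<^sub>R x n)" using conv convergent_imp_Bseq by blast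
  then obtain K1 where K1: "\<And>n. norm (f n - l *\<^sub>R x n) \<le> K1" by (auto simp: Bseq_def)
  obtain K2 where K2: "\<And>n. norm (x n) \<le> K2" using bx by (auto simp: Bseq_def)
  \<comment> \<open>Compactness acts on pairs, so \<open>f n\<close> must be bounded too: it is the
    convergent residual plus \<open>l x n\<close>.\<close>
  have "norm (z n) \<le> K2 + (K1 + \<bar>l\<bar> * K2)" for n
  proof -
    have "norm (f n) \<le> norm (f n - l *\<^sub>R x n) + norm (l *\<^sub>R x n)"
      using norm_triangle_ineq[of "f n - l *\<^sub>R x n" "l *\<^sub>R x n"] by simp
    also have "\<dots> \<le> K1 + \<bar>l\<bar> * K2" using K1[of n] mult_left_mono[OF K2[of n], of "\<bar>l\<bar>"] by simp
    finally show ?thesis using norm_Pair_le[of "x n" "f n"] K2[of n] by (simp add: z_def)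
  qed
  then have "bounded (range z)" by (auto simp: bounded_iff)
  then have "compact (closure ((\<lambda>z. orth_proj T z - orth_proj S z) ` range z))"
    using K by (simp add: compact_operator_def)
  moreover have "\<forall>n. k n \<in> closure ((\<lambda>z. orth_proj T z - orth_proj S z) ` range z)"
    using closure_subset by (fastforce simp: k_def)
  ultimately obtain r k0 where r: "strict_mono r" "(k \<circ> r) \<longlonglongrightarrow> k0"
    unfolding compact_def by metis
  have "orth_proj T (z n) = z n" for n
    using xf by (intro orth_proj_eqI[OF T]) (auto simp: z_def)
  then have zk: "orth_proj S (z n) = z n - k n" for n by (simp add: k_def)
  have "z n - k n \<in> S" for n using orth_proj_mem[OF S, of "z n"] by (simp add: zk)
  \<comment> \<open>Along \<open>r\<close> the corrections \<open>k\<close> converge, so these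
    projected pairs keep a bounded first component and a convergent residual, as properness of
    \<open>S\<close> requires.\<close>
  then have inS: "\<forall>n. (x (r n) - fst (k (r n)), f (r n) - snd (k (r n))) \<in> S"
    by (metis z_def fst_conv snd_conv minus_prod_def)
  have k1: "(\<lambda>n. fst (k (r n))) \<longlonglongrightarrow> fst k0" and k2: "(\<lambda>n. snd (k (r n))) \<longlonglongrightarrow> snd k0"
    using tendsto_fst[OF r(2)] tendsto_snd[OF r(2)] by (simp_all add: o_def)
  have "Bseq (\<lambda>n. fst (k (r n)))" using k1 convergentI convergent_imp_Bseq by blast
  then obtain M1 where M: "\<And>n. norm (fst (k (r n))) \<le> M1" by (auto simp: Bseq_def)
  have "Bseq (\<lambda>n. x (r n) - fst (k (r n)))"
  proof (rule BseqI')
    show "norm (x (r n) - fst (k (r n))) \<le> K2 + M1" for n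
      using norm_triangle_ineq4[of "x (r n)" "fst (k (r n))"] K2[of "r n"] M[of n] by linarith
  qed
  moreover have "convergent (\<lambda>n. (f (r n) - snd (k (r n))) - l *\<^sub>R (x (r n) - fst (k (r n))))"
  proof -
    obtain h where h: "(\<lambda>n. f n - l *\<^sub>R x n) \<longlonglongrightarrow> h" using conv by (auto simp: convergent_def)
    have "(\<lambda>n. ((\<lambda>n. f n - l *\<^sub>R x n) \<circ> r) n - (snd (k (r n)) - l *\<^sub>R fst (k (r n)))) \<longlonglongrightarrow> h - (snd k0 - l *\<^sub>R fst k0)"
      by (intro tendsto_diff LIMSEQ_subseq_LIMSEQ[OF h r(1)] tendsto_scaleR tendsto_const k1 k2)
    then show ?thesis by (intro convergentI) (simp add: algebra_simps)
  qed
  ultimately obtain r' where r': "strict_mono r'"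
      "convergent (\<lambda>n. x (r (r' n)) - fst (k (r (r' n))))"
    using pr[unfolded proper_at_def, rule_format,
      of "\<lambda>n. x (r n) - fst (k (r n))" "\<lambda>n. f (r n) - snd (k (r n))"] inS by auto
  have "convergent (\<lambda>n. fst (k (r (r' n))))"
    using LIMSEQ_subseq_LIMSEQ[OF k1 r'(1)] by (simp add: o_def convergentI)
  from convergent_add[OF r'(2) this] have "convergent (\<lambda>n. x ((r \<circ> r') n))" by simp
  then show "\<exists>r. strict_mono r \<and> convergent (\<lambda>n. x (r n))"
    using strict_mono_o[OF r(1) r'(1)] by blast
qed

theorem theorem5p1:
  fixes T S :: "('a::complex_hilbert \<times> 'a) set"
  assumes "self_adjoint_rel T" and "self_adjoint_rel S"
    and "compact_perturbation T S"
  shows "ess_spectrum_rel T = ess_spectrum_rel S \<and>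
         (ess_spectrum_rel S = {} \<longleftrightarrow> ess_spectrum_rel T = {})"
proof -
  \<comment> \<open>Both essential spectra are real, so comparing them at real points
    suffices.\<close>
  have real: "w = of_real (Re w)" if "self_adjoint_rel A" "w \<in> ess_spectrum_rel A"
    for w and A :: "('a \<times> 'a) set"
    using that by (intro spectrum_self_adjoint_real) (auto simp: ess_spectrum_rel_def)
  have "proper_at T l \<longleftrightarrow> proper_at S l" for l
    using assms(3) compact_perturbation_sym proper_at_compact_perturbation by blast
  then have "of_real l \<in> ess_spectrum_rel T \<longleftrightarrow> of_real l \<in> ess_spectrum_rel S" for l
    by (simp add: of_real_ess_spectrum_iff assms)
  then have "ess_spectrum_rel T = ess_spectrum_rel S"
    using real[OF assms(1)] real[OF assms(2)] by (metis set_eqI)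
  then show ?thesis by simp
qed

end
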